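(* Let $n\ge 1$, $1\le k\le n$, and let $\lambda=(\lambda_1,\dots,\lambda_n)$ be a partition with at most $n$ parts (padded with zeros to length $n$). For a $k$-element subset $I=\{i_1<\dots<i_k\}\subseteq\{1,\dots,n\}$ let $D^{I}$ be the $n\times n$ matrix with entries $$D^I_{r,c}=\begin{cases} S_{\lambda_r-r+c}[X^{tq}+X^t] & c\in I,\\ S_{\lambda_r-r+c}[X^{tq}] & c\notin I,\end{cases}\qquad 1\le r,c\le n.$$ Then $$M_k\,S_\lambda[X^{tq}]=\sum_{1\le i_1<\dots<i_k\le n} t^{(n-i_1)+\cdots+(n-i_k)}\,\det D^{\{i_1,\dots,i_k\}}.$$
   Context: Plethystic notation: for a rational function $E$ in $x_1,\dots,x_n,q,t$ with real coefficients and $i\ge1$, $p_i[E]$ is obtained from $E$ by replacing each of $x_1,\dots,x_n,q,t$ by its $i$-th power (coefficients unchanged); for a symmetric function $f$, $f[E]$ is defined by expanding $f$ in the power sums $p_i$. $S_j$ denotes the complete homogeneous symmetric function of degree $j$ ($S_0=1$, $S_j=0$ for $j<0$), and for a partition $\lambda$ with at most $m$ parts, $S_\lambda[E]=\det(S_{\lambda_r-r+c}[E])_{r,c=1}^m$ (Schur function). Put $X=x_1+\cdots+x_n$, $X^{tq}=X(t-1)/(q-1)$, $X^t=X(t-1)$. For $I\subseteq\{1,\dots,n\}$ let $X_I=\sum_{i\in I}x_i$, $X_I^c=\sum_{i\notin I}x_i$, and for alphabets (sums of variables) $A,B$ let $R(A,B)=\prod_{a\in A,b\in B}(a-b)$,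 so $R(tX_I,X_I^c)=\prod_{i\in I,j\notin I}(tx_i-x_j)$. Let $\Theta_l$ be the operator replacing $x_l$ by $qx_l$ (i.e. $f[X]\mapsto f[X+(q-1)x_l]$). The Macdonald operators acting on symmetric functions of $x_1,\dots,x_n$ (with coefficients in $\mathbb{Q}(q,t)$) are $$M_k=t^{\binom k2}\sum_{I=\{i_1,\dots,i_k\}}R(tX_I,X_I^c)\,\Theta_{i_k}\cdots\Theta_{i_1},$$ the sum over all $k$-element subsets $I$ of $\{1,\dots,n\}$.
   Formalization: The operators M_k are taken with coefficients R(tX_I,X_I^c)/R(X_I,X_I^c), the standard Macdonald operators; without these denominators the identity fails, e.g. for n=2, k=1, λ=(0,0), where the left side is (t-1)(x_1+x_2) and the right side is t+1. *)

theory Defs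
  imports
    "HOL-Library.Poly_Mapping"
    "HOL-Computational_Algebra.Fraction_Field"
    "Jordan_Normal_Form.Determinant"
begin

section \<open>Polynomials and rational functions with real coefficients\<close>

text \<open>Variables are numbered by natural numbers; a monomial is its exponent vector.\<close>

type_synonym mpoly = "(nat \<Rightarrow>\<^sub>0 nat) \<Rightarrow>\<^sub>0 real"

type_synonym ratfun = "mpoly fract"

definition const :: "real \<Rightarrow> mpoly"
  where "const a = Poly_Mapping.single 0 a"

definition pvar :: "nat \<Rightarrow> mpoly"
  where "pvar v = Poly_Mapping.single (Poly_Mapping.single v 1) 1"

text \<open>\<open>insertion h \<sigma> P\<close> evaluates \<open>P\<close> at \<open>\<sigma>\<close> in a commutative ring whose real scalars
  are given by \<open>h\<close>.\<close>

definition insertion :: "(real \<Rightarrow> 'a::comm_ring_1) \<Rightarrow> (nat \<Rightarrow> 'a) \<Rightarrow> mpoly \<Rightarrow> 'a"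
  where "insertion h \<sigma> P =
    (\<Sum>m\<in>Poly_Mapping.keys P.
       h (Poly_Mapping.lookup P m) *
       (\<Prod>v\<in>Poly_Mapping.keys m. \<sigma> v ^ Poly_Mapping.lookup m v))"

definition rconst :: "real \<Rightarrow> ratfun"
  where "rconst a = Fract (const a) 1"

definition rvar :: "nat \<Rightarrow> ratfun"
  where "rvar v = Fract (pvar v) 1"

text \<open>Substitution of \<open>\<sigma> v\<close> for each variable \<open>v\<close> in a rational function: substitute in numerator
  and denominator of any representation whose denominator does not vanish under the
  substitution; the result does not depend on the representation.\<close>

definition rsubst :: "(nat \<Rightarrow> ratfun) \<Rightarrow> ratfun \<Rightarrow> ratfun"
  where "rsubst \<sigma> E =
    (THE F. \<exists>a b. b \<noteq> 0 \<and> E = Fract a b \<and> insertion rconst \<sigma> b \<noteq> 0 \<and>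
       F = insertion rconst \<sigma> a / insertion rconst \<sigma> b)"

text \<open>The indeterminates \<open>q\<close>, \<open>t\<close> and \<open>x\<^sub>1, x\<^sub>2, \<dots>\<close> are the variables 0, 1 and 2, 3, \<open>\<dots>\<close>;
  \<open>xvar i\<close> is meant for \<open>i \<ge> 1\<close> (\<open>xvar 0\<close> would be \<open>t\<close>).\<close>

abbreviation qvar :: ratfun
  where "qvar \<equiv> rvar 0"

abbreviation tvar :: ratfun
  where "tvar \<equiv> rvar 1"

abbreviation xvar :: "nat \<Rightarrow> ratfun"
  where "xvar i \<equiv> rvar (i + 1)"


section \<open>Symmetric functions and plethystic substitution\<close>

text \<open>A symmetric function is represented by the family of its restrictions to finitely many
  variables: the \<open>N\<close>-th member is the symmetric polynomial in the variables \<open>0, \<dots>, N - 1\<close>.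
  These variables have nothing to do with \<open>q\<close>, \<open>t\<close>, \<open>x\<^sub>i\<close> above.\<close>

type_synonym symfun = "nat \<Rightarrow> mpoly"

definition power_sum :: "nat \<Rightarrow> symfun"
  where "power_sum i N = (\<Sum>v<N. pvar v ^ i)"

definition monom_degree :: "(nat \<Rightarrow>\<^sub>0 nat) \<Rightarrow> nat"
  where "monom_degree m = (\<Sum>v\<in>Poly_Mapping.keys m. Poly_Mapping.lookup m v)"

text \<open>\<open>S\<^sub>j\<close> is the sum of all monomials of degree \<open>j\<close>, for any integer \<open>j\<close>; for negative \<open>j\<close> there
  are none.\<close>

definition complete_sym :: "int \<Rightarrow> symfun"
  where "complete_sym j N =
    (\<Sum>m | Poly_Mapping.keys m \<subseteq> {..<N} \<and> int (monom_degree m) = j. Poly_Mapping.single m 1)"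

text \<open>The expansion of a symmetric function in the power sums, as a polynomial whose variable \<open>i\<close>
  stands for the power sum of degree \<open>i + 1\<close>. It is unique, since the power sums are
  algebraically independent.\<close>

definition power_sum_expansion :: "symfun \<Rightarrow> mpoly"
  where "power_sum_expansion f =
    (THE P. \<forall>N. insertion const (\<lambda>i. power_sum (i + 1) N) P = f N)"

definition power_sum_pleth :: "nat \<Rightarrow> ratfun \<Rightarrow> ratfun"
  where "power_sum_pleth i E = rsubst (\<lambda>v. rvar v ^ i) E"

definition pleth :: "symfun \<Rightarrow> ratfun \<Rightarrow> ratfun"
  where "pleth f E =
    insertion rconst (\<lambda>i. power_sum_pleth (i + 1) E) (power_sum_expansion f)"

text \<open>Matrix indices in \<^const>\<open>mat\<close> start at 0, whereas partitions are indexed from 1.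
  The 0-based entry at \<open>(r, c)\<close> is \<open>S\<^bsub>\<lambda>\<^sub>R - R + C\<^esub>\<close> for \<open>R = r + 1\<close>, \<open>C = c + 1\<close>.\<close>

definition jt_index :: "(nat \<Rightarrow> nat) \<Rightarrow> nat \<Rightarrow> nat \<Rightarrow> int"
  where "jt_index lam r c = int (lam r) - int r + int c"

definition schur_pleth :: "nat \<Rightarrow> (nat \<Rightarrow> nat) \<Rightarrow> ratfun \<Rightarrow> ratfun"
  where "schur_pleth m lam E =
    det (mat m m (\<lambda>(r, c). pleth (complete_sym (jt_index lam (r + 1) (c + 1))) E))"


section \<open>Alphabets and Macdonald operators\<close>

definition Xsum :: "nat \<Rightarrow> ratfun"
  where "Xsum n = (\<Sum>i = 1..n. xvar i)"

definition Xtq :: "nat \<Rightarrow> ratfun"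
  where "Xtq n = Xsum n * (tvar - 1) / (qvar - 1)"

definition Xt :: "nat \<Rightarrow> ratfun"
  where "Xt n = Xsum n * (tvar - 1)"

definition resultant :: "ratfun set \<Rightarrow> ratfun set \<Rightarrow> ratfun"
  where "resultant A B = (\<Prod>a\<in>A. \<Prod>b\<in>B. a - b)"

definition Theta :: "nat \<Rightarrow> ratfun \<Rightarrow> ratfun"
  where "Theta l = rsubst (rvar(l + 1 := qvar * xvar l))"

text \<open>The \<^const>\<open>fold\<close> below is \<open>\<Theta>\<^bsub>i\<^sub>k\<^esub> \<cdots> \<Theta>\<^bsub>i\<^sub>1\<^esub>\<close>, with \<open>\<Theta>\<^bsub>i\<^sub>1\<^esub>\<close> applied first.
  The Macdonald operators carry the denominators \<open>R(X\<^sub>I, X\<^sub>I\<^sup>c)\<close>, so that the coefficient of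
  \<open>\<Theta>\<^sub>I\<close> is \<open>t\<close> to the power \<open>k\<close> choose 2 times the product over \<open>i \<in> I\<close>, \<open>j \<notin> I\<close> of
  \<open>(t x\<^sub>i - x\<^sub>j) / (x\<^sub>i - x\<^sub>j)\<close>. With the numerators alone the operators do not satisfy the
  determinantal expansion: already for \<open>n = 2\<close>, \<open>k = 1\<close> they send 1 to
  \<open>(t - 1) (x\<^sub>1 + x\<^sub>2)\<close> instead of \<open>t + 1\<close>.\<close>

definition macdonald :: "nat \<Rightarrow> nat \<Rightarrow> ratfun \<Rightarrow> ratfun"
  where "macdonald n k f =
    tvar ^ (k choose 2) *
    (\<Sum>I | I \<subseteq> {1..n} \<and> card I = k.
       resultant ((\<lambda>i. tvar * xvar i) ` I) (xvar ` ({1..n} - I)) /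
       resultant (xvar ` I) (xvar ` ({1..n} - I)) *
       fold Theta (sorted_list_of_set I) f)"

definition D_mat :: "nat \<Rightarrow> (nat \<Rightarrow> nat) \<Rightarrow> nat set \<Rightarrow> ratfun mat"
  where "D_mat n lam I =
    mat n n (\<lambda>(r, c).
      pleth (complete_sym (jt_index lam (r + 1) (c + 1)))
        (if c + 1 \<in> I then Xtq n + Xt n else Xtq n))"

end

theory Submission
  imports Defs "HOL-Library.FuncSet" "HOL-Computational_Algebra.Polynomial_FPS"
begin

text \<open>
  Let \<open>G(z)\<close> be the generating function of the \<open>S\<^sub>j[X\<^sup>t\<^sup>q]\<close>, divided by \<open>\<Prod>i. 1 - t x\<^sub>i z\<close>. Since \<open>\<Theta>\<^sub>I\<close>
  turns \<open>X\<^sup>t\<^sup>q\<close> into \<open>X\<^sup>t\<^sup>q + (t - 1) X\<^sub>I\<close>, the determinants on both sides have entries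
  \<open>\<phi>\<^sub>r (w\<^sup>c P\<^sub>I(w))\<close>, where \<open>P\<^sub>I(w)\<close> is the product of the \<open>w - x\<^sub>i\<close> with \<open>i \<in> I\<close> and of the
  \<open>w - t x\<^sub>j\<close> with \<open>j \<notin> I\<close>, and \<open>\<phi>\<^sub>r\<close> is a linear functional given by coefficients of \<open>G\<close>. On the
  right-hand side, \<open>I\<close> is everything in the chosen columns and empty in the others. All polynomials
  have degree below \<open>2n\<close>, so \<open>\<phi>\<^sub>r\<close> is a combination of evaluations at the \<open>2n\<close> points
  \<open>x\<^sub>i\<close> and \<open>t x\<^sub>i\<close>; by multilinearity in the rows it suffices to evaluate every row at one of these points.
  Then at most one subset \<open>I\<close> contributes to the left-hand side, namely the set of the \<open>i\<close> for
  which \<open>t x\<^sub>i\<close> is used, and both sides are explicit multiples of Vandermonde determinants.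
\<close>

section \<open>Determinants and Vandermonde systems\<close>

lemma det_mat_Leibniz:
  "det (mat n n (\<lambda>(r, c). M r c)) =
    (\<Sum>p | p permutes {0..<n}. signof p * (\<Prod>r = 0..<n. M r (p r)))"
  for M :: "nat \<Rightarrow> nat \<Rightarrow> 'a::comm_ring_1"
proof -
  have "(\<Prod>r = 0..<n. mat n n (\<lambda>(r, c). M r c) $$ (r, p r)) = (\<Prod>r = 0..<n. M r (p r))"
    if "p permutes {0..<n}" for p
  proof (rule prod.cong[OF refl])
    fix r assume "r \<in> {0..<n}"
    then have "p r < n" using permutes_in_image[OF that, of r] by auto
    with \<open>r \<in> _\<close> show "mat n n (\<lambda>(r, c). M r c) $$ (r, p r) = M r (p r)" by auto
  qed
  then show ?thesis unfolding det_def by simp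
qed

lemma det_scale_rows:
  "det (mat n n (\<lambda>(r, c). a r * M r c)) = (\<Prod>r<n. a r) * det (mat n n (\<lambda>(r, c). M r c))"
  for M :: "nat \<Rightarrow> nat \<Rightarrow> 'a::comm_ring_1"
  unfolding det_mat_Leibniz
  by (simp add: prod.distrib sum_distrib_left mult_ac lessThan_atLeast0)

text \<open>Multilinearity in all rows at once. Every row draws on the same family \<open>M\<close>,
  so a choice \<open>f\<close> may repeat an index; such choices are kept in the sum.\<close>

lemma det_rows_combination:
  fixes M :: "'b \<Rightarrow> nat \<Rightarrow> 'a::comm_ring_1"
  assumes "finite S"
  shows "det (mat n n (\<lambda>(r, c). \<Sum>s\<in>S. a r s * M s c)) =
    (\<Sum>f\<in>PiE {0..<n} (\<lambda>_. S). (\<Prod>r = 0..<n. a r (f r)) * det (mat n n (\<lambda>(r, c). M (f r) c)))"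
proof -
  have "det (mat n n (\<lambda>(r, c). \<Sum>s\<in>S. a r s * M s c)) =
      (\<Sum>p | p permutes {0..<n}. \<Sum>f\<in>PiE {0..<n} (\<lambda>_. S).
         signof p * (\<Prod>r = 0..<n. a r (f r) * M (f r) (p r)))"
    unfolding det_mat_Leibniz using assms
    by (intro sum.cong refl, subst prod_sum_PiE) (auto simp: sum_distrib_left)
  also have "\<dots> = (\<Sum>f\<in>PiE {0..<n} (\<lambda>_. S). \<Sum>p | p permutes {0..<n}.
         signof p * (\<Prod>r = 0..<n. a r (f r) * M (f r) (p r)))"
    by (rule sum.swap)
  finally show ?thesis
    by (simp add: det_mat_Leibniz prod.distrib sum_distrib_left mult_ac)
qed

lemma det_equal_rows:
  fixes M :: "nat \<Rightarrow> nat \<Rightarrow> 'a::comm_ring_1"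
  assumes "r < n" "s < n" "r \<noteq> s" "\<And>c. c < n \<Longrightarrow> M r c = M s c"
  shows "det (mat n n (\<lambda>(r, c). M r c)) = 0"
  by (rule det_identical_rows[of _ n r s]) (use assms in \<open>auto intro!: eq_vecI\<close>)

text \<open>Coefficients of \<open>x ^ c\<close> in the Newton basis \<open>\<Prod>i<j. (x - w i)\<close>.\<close>

fun newton_coeff :: "(nat \<Rightarrow> 'a::comm_ring_1) \<Rightarrow> nat \<Rightarrow> nat \<Rightarrow> 'a" where
  "newton_coeff w 0 j = (if j = 0 then 1 else 0)"
| "newton_coeff w (Suc c) 0 = w 0 * newton_coeff w c 0"
| "newton_coeff w (Suc c) (Suc j) = newton_coeff w c j + w (Suc j) * newton_coeff w c (Suc j)"

lemma newton_coeff_eq_0: "c < j \<Longrightarrow> newton_coeff w c j = 0"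
  by (induction w c j rule: newton_coeff.induct) auto

lemma newton_coeff_diag: "newton_coeff w c c = 1"
  by (induction c) (auto simp: newton_coeff_eq_0)

lemma power_newton_basis:
  assumes "c < n"
  shows "x ^ c = (\<Sum>j<n. newton_coeff w c j * (\<Prod>i<j. x - w i))"
  using assms
proof (induction c arbitrary: n)
  case 0
  then have "(\<Sum>j<n. newton_coeff w 0 j * (\<Prod>i<j. x - w i)) =
      (\<Sum>j<n. if j = 0 then 1 else 0)"
    by (intro sum.cong) auto
  then show ?case using 0 by (simp add: sum.delta)
next
  case (Suc c)
  then obtain m where n: "n = Suc m" and "c < m" by (cases n) auto
  let ?N = "\<lambda>j. \<Prod>i<j. x - w i"
  have "x ^ Suc c = (\<Sum>j<m. newton_coeff w c j * (?N j * x))"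
    using Suc.IH[OF \<open>c < m\<close>] by (simp add: sum_distrib_left sum_distrib_right mult_ac)
  also have "\<dots> = (\<Sum>j<m. newton_coeff w c j * ?N (Suc j)) + (\<Sum>j<m. w j * newton_coeff w c j * ?N j)"
    by (simp add: algebra_simps flip: sum.distrib)
  also have "(\<Sum>j<m. w j * newton_coeff w c j * ?N j) = (\<Sum>j<Suc m. w j * newton_coeff w c j * ?N j)"
    using \<open>c < m\<close> by (simp add: newton_coeff_eq_0)
  also have "\<dots> = w 0 * newton_coeff w c 0 + (\<Sum>j<m. w (Suc j) * newton_coeff w c (Suc j) * ?N (Suc j))"
    by (subst sum.lessThan_Suc_shift) simp
  finally show ?case
    unfolding n sum.lessThan_Suc_shift
    by (simp add: algebra_simps sum.distrib del: prod.lessThan_Suc)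
qed

text \<open>Expanding powers in the Newton basis with nodes \<open>w i\<close> factors the matrix
  into \<open>N\<close> times the transpose of \<open>C\<close>. \<open>C\<close> is unitriangular,
  and \<open>N\<close> is lower triangular because \<open>\<Prod>i<j. w r - w i\<close> contains the
  zero factor \<open>i = r\<close> once \<open>r < j\<close>. The diagonal of \<open>N\<close>
  yields the product.\<close>

lemma det_vandermonde:
  fixes w :: "nat \<Rightarrow> 'a::comm_ring_1"
  shows "det (mat n n (\<lambda>(r, c). w r ^ c)) = (\<Prod>s<n. \<Prod>r<s. w s - w r)"
proof -
  define N where "N = mat n n (\<lambda>(r, j). \<Prod>i<j. w r - w i)"
  define C where "C = mat n n (\<lambda>(c, j). newton_coeff w c j)"
  have carr: "N \<in> carrier_mat n n" "C \<in> carrier_mat n n" by (auto simp: N_def C_def)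
  have "mat n n (\<lambda>(r, c). w r ^ c) = N * transpose_mat C"
  proof (rule eq_matI)
    fix r c assume "r < dim_row (N * transpose_mat C)" "c < dim_col (N * transpose_mat C)"
    then have "r < n" "c < n" using carr by auto
    then show "mat n n (\<lambda>(r, c). w r ^ c) $$ (r, c) = (N * transpose_mat C) $$ (r, c)"
      using power_newton_basis[of c n "w r" w]
      by (simp add: N_def C_def scalar_prod_def lessThan_atLeast0 mult.commute)
  qed (auto simp: N_def C_def)
  then have "det (mat n n (\<lambda>(r, c). w r ^ c)) = det N * det C"
    using carr by (simp add: det_mult[of _ n] det_transpose)
  moreover have "det C = 1"
    by (subst det_lower_triangular[of n])
       (auto simp: C_def newton_coeff_eq_0 newton_coeff_diag diag_mat_def prod.list_conv_set_nth)
  moreover have "det N = (\<Prod>s<n. \<Prod>r<s. w s - w r)"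
  proof (subst det_lower_triangular[of n])
    show "prod_list (diag_mat N) = (\<Prod>s<n. \<Prod>r<s. w s - w r)"
      by (simp add: N_def diag_mat_def prod.list_conv_set_nth lessThan_atLeast0)
    show "N $$ (i, j) = 0" if "i < j" "j < n" for i j
      using that by (auto simp: N_def intro!: prod_zero)
  qed (use carr in auto)
  ultimately show ?thesis by simp
qed

text \<open>Lagrange interpolation: a linear functional on polynomials of degree below
  \<open>card S\<close>, given by its moments \<open>\<gamma> d\<close>, is a combination of
  evaluations at the nodes. The weights are its values on the Lagrange basis
  \<open>L\<close>.\<close>

lemma vandermonde_system_solvable:
  fixes node :: "'b \<Rightarrow> 'a::field"
  assumes "finite S" "inj_on node S"
  obtains \<alpha> where "\<And>d. d < card S \<Longrightarrow> \<gamma> d = (\<Sum>s\<in>S. \<alpha> s * node s ^ d)"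
proof -
  define L where "L s = (\<Prod>u\<in>S - {s}. smult (1 / (node s - node u)) [:- node u, 1:])" for s
  define \<alpha> where "\<alpha> s = (\<Sum>e<card S. coeff (L s) e * \<gamma> e)" for s
  have degL: "degree (L s) < card S" if "s \<in> S" for s
  proof -
    have "degree (L s) \<le> sum (degree \<circ> (\<lambda>u. smult (1 / (node s - node u)) [:- node u, 1:])) (S - {s})"
      unfolding L_def by (rule degree_prod_sum_le) (use assms in auto)
    also have "\<dots> \<le> (\<Sum>u\<in>S - {s}. 1)"
      by (intro sum_mono) (auto simp: degree_smult_eq)
    also have "\<dots> < card S"
      using assms(1) that by (auto simp: card_gt_0_iff intro!: diff_less)
    finally show ?thesis .
  qed
  have evalL: "poly (L s) (node u) = (if u = s then 1 else 0)" if "s \<in> S" "u \<in> S" for s u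
  proof (cases "u = s")
    case True
    have "poly (smult (1 / (node s - node v)) [:- node v, 1:]) (node s) = 1" if "v \<in> S - {s}" for v
    proof -
      have "node s - node v \<noteq> 0" using assms \<open>s \<in> S\<close> that by (auto simp: inj_on_def)
      then have "(node s - node v) / (node s - node v) = 1" by (rule divide_self)
      then show ?thesis by (simp add: diff_divide_distrib del: divide_self_if)
    qed
    then have "(\<Prod>v\<in>S - {s}. poly (smult (1 / (node s - node v)) [:- node v, 1:]) (node s)) = 1"
      by (intro prod.neutral) auto
    then show ?thesis using True by (simp add: L_def poly_prod)
  next
    case False
    then show ?thesis using that assms(1) by (auto simp: L_def poly_prod intro!: prod_zero)
  qed
  have "\<gamma> d = (\<Sum>s\<in>S. \<alpha> s * node s ^ d)" if d: "d < card S" for d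
  proof -
    \<comment> \<open>The monomial is its own interpolant: both sides have degree below the number
      of nodes, and they agree at all nodes.\<close>
    have "monom 1 d = (\<Sum>s\<in>S. smult (node s ^ d) (L s))"
    proof (rule poly_eqI_degree)
      fix y assume "y \<in> node ` S"
      then obtain u where u: "u \<in> S" "y = node u" by auto
      have "(\<Sum>s\<in>S. poly (smult (node s ^ d) (L s)) (node u)) =
          (\<Sum>s\<in>S. if u = s then node u ^ d else 0)"
        by (intro sum.cong) (auto simp: evalL u)
      then show "poly (monom 1 d) y = poly (\<Sum>s\<in>S. smult (node s ^ d) (L s)) y"
        using u assms by (simp add: poly_sum poly_monom)
    next
      have c: "card (node ` S) = card S" using assms by (simp add: card_image)
      show "degree (monom (1::'a) d) < card (node ` S)" using d c by (simp add: degree_monom_eq)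
      have "degree (\<Sum>s\<in>S. smult (node s ^ d) (L s)) \<le> card S - 1"
      proof (rule degree_sum_le[OF assms(1)])
        show "degree (smult (node s ^ d) (L s)) \<le> card S - 1" if "s \<in> S" for s
          using degL[OF that] degree_smult_le[of "node s ^ d" "L s"] by linarith
      qed
      then show "degree (\<Sum>s\<in>S. smult (node s ^ d) (L s)) < card (node ` S)"
        using d c by simp
    qed
    then have "coeff (monom 1 d) e = (\<Sum>s\<in>S. node s ^ d * coeff (L s) e)" for e
      by (simp add: coeff_sum)
    then have eq: "(\<Sum>s\<in>S. node s ^ d * coeff (L s) e) = (if d = e then 1 else 0)" for e
      by (metis coeff_monom)
    have "(\<Sum>s\<in>S. \<alpha> s * node s ^ d) = (\<Sum>s\<in>S. \<Sum>e<card S. \<gamma> e * (node s ^ d * coeff (L s) e))"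
      unfolding \<alpha>_def by (simp add: sum_distrib_left sum_distrib_right mult_ac)
    also have "\<dots> = (\<Sum>e<card S. \<gamma> e * (\<Sum>s\<in>S. node s ^ d * coeff (L s) e))"
      by (subst sum.swap) (simp add: sum_distrib_left)
    also have "\<dots> = (\<Sum>e<card S. if d = e then \<gamma> e else 0)"
      by (intro sum.cong refl) (simp add: eq)
    also have "\<dots> = \<gamma> d" using d by simp
    finally show ?thesis by simp
  qed
  then show thesis by (rule that)
qed

section \<open>Products over pairs of indices\<close>

lemma prod_square_pairs:
  fixes G :: "nat \<Rightarrow> nat \<Rightarrow> 'a::comm_monoid_mult"
  assumes "\<And>r. r < n \<Longrightarrow> G r r = 1"
  shows "(\<Prod>r<n. \<Prod>s<n. G r s) = (\<Prod>s<n. \<Prod>r<s. G r s * G s r)"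
  using assms
proof (induction n)
  case (Suc n)
  then show ?case by (simp add: prod.distrib mult_ac)
qed simp

text \<open>The exponent counts pairs of marked indices. A newly marked \<open>n\<close> forms a
  pair with every earlier marked index, which is Pascal's rule for \<open>choose 2\<close>.\<close>

lemma prod_pairs_indicator:
  fixes t :: "'a::comm_monoid_mult" and n :: nat
  shows "(\<Prod>s<n. \<Prod>r<s. if b r \<and> b s then t else 1) = t ^ (card {r. r < n \<and> b r} choose 2)"
proof (induction n)
  case (Suc n)
  let ?C = "{r. r < n \<and> b r}"
  have *: "(\<Prod>r<n. if b r then t else 1) = t ^ card ?C"
    by (subst prod.If_cases) (auto simp: Int_def)
  have "{r. r < Suc n \<and> b r} = (if b n then insert n ?C else ?C)"
    by (auto simp: less_Suc_eq)
  then have "card {r. r < Suc n \<and> b r} = (if b n then Suc (card ?C) else card ?C)" by simp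
  then have card: "card {r. r < Suc n \<and> b r} choose 2 = (if b n then card ?C else 0) + (card ?C choose 2)"
    by (simp add: numeral_2_eq_2)
  have "(\<Prod>r<n. if b r \<and> b n then t else 1) = t ^ (if b n then card ?C else 0)"
    using * by (cases "b n") auto
  then show ?case unfolding prod.lessThan_Suc Suc.IH card power_add by (simp only: mult.commute)
qed (simp add: binomial_eq_0)

section \<open>The determinantal identity\<close>

text \<open>The polynomial \<open>P_I\<close> of the overview. The columns on the right-hand side
  use the extreme cases \<open>I = {1..n}\<close> and \<open>I = {}\<close>.\<close>

definition mixed_poly :: "nat \<Rightarrow> (nat \<Rightarrow> 'a::comm_ring_1) \<Rightarrow> 'a \<Rightarrow> nat set \<Rightarrow> 'a poly" where
  "mixed_poly n x t I = (\<Prod>i\<in>I. [:- x i, 1:]) * (\<Prod>j\<in>{1..n} - I. [:- (t * x j), 1:])"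

lemma poly_mixed_poly:
  "poly (mixed_poly n x t I) y = (\<Prod>i\<in>I. y - x i) * (\<Prod>j\<in>{1..n} - I. y - t * x j)"
  by (simp add: mixed_poly_def poly_prod)

lemma finite_subsets_card [simp]: "finite {I. I \<subseteq> {1..n::nat} \<and> card I = k}"
  by (rule finite_subset[of _ "Pow {1..n}"]) auto

text \<open>This is the right-hand side once row \<open>r\<close> has been evaluated at the node
  \<open>w r\<close>. In the Leibniz expansion each permutation is compatible with exactly one
  column set, and the resulting power of \<open>t\<close> does not depend on the permutation, so a
  Vandermonde determinant in the unscaled \<open>x\<close> remains.\<close>

lemma sum_over_column_choices:
  fixes x y :: "nat \<Rightarrow> 'a::comm_ring_1" and t :: 'a and b :: "nat \<Rightarrow> bool"
  defines "w \<equiv> \<lambda>r. (if b r then t else 1) * x r"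
  shows "(\<Sum>I | I \<subseteq> {1..n} \<and> card I = k. t ^ (\<Sum>i\<in>I. n - i) *
      det (mat n n (\<lambda>(r, c). if b r = (c + 1 \<in> I) then y r * w r ^ c else 0))) =
    (if card {r. r < n \<and> b r} = k
     then t ^ (k * (n - 1)) * (\<Prod>r<n. y r) * det (mat n n (\<lambda>(r, c). x r ^ c)) else 0)"
proof -
  let ?F = "{I. I \<subseteq> {1..n} \<and> card I = k}"
  define R where "R = {r. r < n \<and> b r}"
  have inner: "(\<Sum>I\<in>?F. t ^ (\<Sum>i\<in>I. n - i) *
      (\<Prod>r = 0..<n. if b r = (p r + 1 \<in> I) then y r * w r ^ p r else 0)) =
      (if card R = k then t ^ (k * (n - 1)) * (\<Prod>r = 0..<n. y r * x r ^ p r) else 0)"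
    (is "sum ?g _ = _") if p: "p permutes {0..<n}" for p
  proof -
    \<comment> \<open>The only set of 1-based columns for which no factor is forced to be 0: the
      columns that \<open>p\<close> assigns to the marked rows.\<close>
    define Ip where "Ip = (\<lambda>r. Suc (p r)) ` R"
    have inj: "inj_on (\<lambda>r. Suc (p r)) A" for A
      using permutes_inj[OF p] by (auto simp: inj_on_def)
    have pn: "p r < n" if "r < n" for r
      using permutes_in_image[OF p, of r] that by auto
    have mem: "p r + 1 \<in> Ip \<longleftrightarrow> b r" if "r < n" for r
      using inj[of UNIV] that by (auto simp: Ip_def R_def inj_on_def)
    have "?g I = 0" if "I \<in> ?F" "I \<noteq> Ip" for I
    proof -
      have "\<exists>r<n. b r \<noteq> (p r + 1 \<in> I)"
      proof (rule ccontr)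
        assume "\<not> ?thesis"
        then have *: "p r + 1 \<in> I \<longleftrightarrow> b r" if "r < n" for r using that by auto
        have "I = Ip"
        proof (intro equalityI subsetI)
          fix i assume "i \<in> I"
          then have "i \<in> {1..n}" using \<open>I \<in> ?F\<close> by blast
          then have "i - 1 \<in> {0..<n}" and i: "i > 0" by auto
          then obtain r where "r < n" "p r = i - 1"
            using permutes_image[OF p] by (metis atLeastLessThan_iff imageE)
          then show "i \<in> Ip" using *[of r] mem[of r] i \<open>i \<in> I\<close> by auto
        next
          fix i assume "i \<in> Ip"
          then show "i \<in> I" using * by (auto simp: Ip_def R_def)
        qed
        with \<open>I \<noteq> Ip\<close> show False ..
      qed
      then have "(\<Prod>r = 0..<n. if b r = (p r + 1 \<in> I) then y r * w r ^ p r else 0) = 0"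
        by (intro prod_zero) auto
      then show ?thesis by simp
    qed
    then have "sum ?g ?F = (\<Sum>I\<in>?F. if I = Ip then ?g Ip else 0)"
      by (intro sum.cong) auto
    also have "\<dots> = (if Ip \<in> ?F then ?g Ip else 0)" by simp
    also have "Ip \<in> ?F \<longleftrightarrow> card R = k"
      using inj pn by (auto simp: Ip_def card_image R_def Suc_le_eq)
    also have "?g Ip = t ^ (card R * (n - 1)) * (\<Prod>r = 0..<n. y r * x r ^ p r)"
    proof -
      have "(\<Sum>i\<in>Ip. n - i) = (\<Sum>r\<in>R. n - Suc (p r))"
        unfolding Ip_def by (subst sum.reindex) (auto simp: inj)
      then have "t ^ (\<Sum>i\<in>Ip. n - i) = (\<Prod>r\<in>R. t ^ (n - Suc (p r)))"
        by (simp add: power_sum)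
      also have "\<dots> = (\<Prod>r = 0..<n. if b r then t ^ (n - Suc (p r)) else 1)"
        by (subst prod.If_cases) (auto simp: R_def Int_def intro!: prod.cong)
      finally have "?g Ip = (\<Prod>r = 0..<n. (if b r then t ^ (n - Suc (p r)) else 1) * (y r * w r ^ p r))"
        using mem by (simp add: prod.distrib)
      also have "\<dots> = (\<Prod>r = 0..<n. (if b r then t ^ (n - 1) else 1) * (y r * x r ^ p r))"
      proof (rule prod.cong[OF refl])
        fix r assume "r \<in> {0..<n}"
        \<comment> \<open>The weight of column \<open>p r + 1\<close> and the power of
          \<open>t\<close> inside \<open>w r ^ p r\<close> have complementary exponents.\<close>
        then have "n - 1 = (n - Suc (p r)) + p r" using pn[of r] by auto
        then show "(if b r then t ^ (n - Suc (p r)) else 1) * (y r * w r ^ p r) =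
            (if b r then t ^ (n - 1) else 1) * (y r * x r ^ p r)"
          by (simp add: w_def power_mult_distrib power_add mult_ac)
      qed
      also have "\<dots> = (\<Prod>r\<in>R. t ^ (n - 1)) * (\<Prod>r = 0..<n. y r * x r ^ p r)"
        by (subst prod.distrib, subst prod.If_cases) (auto simp: R_def Int_def intro!: prod.cong)
      finally show ?thesis by (simp add: power_mult mult.commute flip: power_mult)
    qed
    finally show ?thesis by simp
  qed
  have "(\<Sum>I\<in>?F. t ^ (\<Sum>i\<in>I. n - i) *
      det (mat n n (\<lambda>(r, c). if b r = (c + 1 \<in> I) then y r * w r ^ c else 0))) =
     (\<Sum>I\<in>?F. \<Sum>p | p permutes {0..<n}. signof p * (t ^ (\<Sum>i\<in>I. n - i) *
      (\<Prod>r = 0..<n. if b r = (p r + 1 \<in> I) then y r * w r ^ p r else 0)))"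
    by (simp add: det_mat_Leibniz sum_distrib_left mult_ac)
  also have "\<dots> = (\<Sum>p | p permutes {0..<n}. signof p *
      (if card R = k then t ^ (k * (n - 1)) * (\<Prod>r = 0..<n. y r * x r ^ p r) else 0))"
    unfolding sum.swap[of _ _ ?F] sum_distrib_left[symmetric]
    by (rule sum.cong[OF refl]) (simp only: inner mem_Collect_eq)
  also have "\<dots> = (if card R = k
     then t ^ (k * (n - 1)) * (\<Prod>r<n. y r) * det (mat n n (\<lambda>(r, c). x r ^ c)) else 0)"
    by (simp add: det_mat_Leibniz prod.distrib sum_distrib_left mult_ac lessThan_atLeast0)
  finally show ?thesis unfolding R_def .
qed

text \<open>Brings a product over \<open>I\<close> and its complement to the shape
  \<open>r < s\<close> of the Vandermonde product, so that the two can be compared factor by factor.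
  A pair contributes when exactly one of its members is marked.\<close>

lemma prod_cross_pairs:
  fixes h :: "nat \<Rightarrow> nat \<Rightarrow> 'a::comm_monoid_mult" and b :: "nat \<Rightarrow> bool"
  assumes \<sigma>: "bij_betw \<sigma> {..<n} {1..n}"
  defines "I \<equiv> \<sigma> ` {r. r < n \<and> b r}"
  shows "(\<Prod>i\<in>I. \<Prod>j\<in>{1..n} - I. h i j) =
    (\<Prod>s<n. \<Prod>r<s. if b r = b s then 1 else if b r then h (\<sigma> r) (\<sigma> s) else h (\<sigma> s) (\<sigma> r))"
proof -
  let ?R = "{r. r < n \<and> b r}" and ?S = "{r. r < n \<and> \<not> b r}"
  have inj: "inj_on \<sigma> A" if "A \<subseteq> {..<n}" for A
    using \<sigma> that by (auto simp: bij_betw_def intro: inj_on_subset)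
  have "\<sigma> ` ({..<n} - ?R) = {1..n} - I"
    using \<sigma> by (subst inj_on_image_set_diff[OF inj[OF order.refl]]) (auto simp: I_def bij_betw_def)
  moreover have "{..<n} - ?R = ?S" by auto
  ultimately have "{1..n} - I = \<sigma> ` ?S" by simp
  then have "(\<Prod>i\<in>I. \<Prod>j\<in>{1..n} - I. h i j) = (\<Prod>r\<in>?R. \<Prod>s\<in>?S. h (\<sigma> r) (\<sigma> s))"
    unfolding I_def using inj[of ?R] inj[of ?S] by (simp add: prod.reindex subset_eq)
  also have "\<dots> = (\<Prod>r<n. if b r then \<Prod>s\<in>?S. h (\<sigma> r) (\<sigma> s) else 1)"
    by (subst prod.If_cases) (auto simp: Int_def)
  also have "\<dots> = (\<Prod>r<n. \<Prod>s<n. if b r \<and> \<not> b s then h (\<sigma> r) (\<sigma> s) else 1)"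
  proof (rule prod.cong[OF refl])
    fix r
    have "(\<Prod>s\<in>?S. h (\<sigma> r) (\<sigma> s)) = (\<Prod>s<n. if \<not> b s then h (\<sigma> r) (\<sigma> s) else 1)"
      by (subst prod.If_cases) (auto simp: Int_def)
    then show "(if b r then \<Prod>s\<in>?S. h (\<sigma> r) (\<sigma> s) else 1) =
        (\<Prod>s<n. if b r \<and> \<not> b s then h (\<sigma> r) (\<sigma> s) else 1)"
      by simp
  qed
  also have "\<dots> = (\<Prod>s<n. \<Prod>r<s. (if b r \<and> \<not> b s then h (\<sigma> r) (\<sigma> s) else 1) *
      (if b s \<and> \<not> b r then h (\<sigma> s) (\<sigma> r) else 1))"
    by (rule prod_square_pairs) auto
  also have "\<dots> = (\<Prod>s<n. \<Prod>r<s. if b r = b s then 1 else if b r then h (\<sigma> r) (\<sigma> s) else h (\<sigma> s) (\<sigma> r))"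
    by (intro prod.cong refl) auto
  finally show ?thesis .
qed

text \<open>Comparison for each pair \<open>r < s\<close>: two marked indices give a factor
  \<open>t\<close>, two unmarked ones give 1, and for a mixed pair the scaled difference is
  exchanged with the unscaled one, with equal signs on both sides.\<close>

lemma vandermonde_scaled_nodes:
  fixes x :: "nat \<Rightarrow> 'a::comm_ring_1" and t :: 'a and b :: "nat \<Rightarrow> bool"
  assumes \<sigma>: "bij_betw \<sigma> {..<n} {1..n}"
  defines "I \<equiv> \<sigma> ` {r. r < n \<and> b r}"
  defines "w \<equiv> \<lambda>r. (if b r then t else 1) * x (\<sigma> r)"
  shows "det (mat n n (\<lambda>(r, c). w r ^ c)) * (\<Prod>i\<in>I. \<Prod>j\<in>{1..n} - I. x i - x j) =
    t ^ (card I choose 2) * det (mat n n (\<lambda>(r, c). x (\<sigma> r) ^ c)) *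
      (\<Prod>i\<in>I. \<Prod>j\<in>{1..n} - I. t * x i - x j)"
proof -
  have "inj_on \<sigma> {r. r < n \<and> b r}"
    using \<sigma> by (auto simp: bij_betw_def intro: inj_on_subset)
  then have card: "card I = card {r. r < n \<and> b r}" by (simp add: I_def card_image)
  show ?thesis
    unfolding det_vandermonde card
    unfolding I_def prod_cross_pairs[OF \<sigma>]
      prod_pairs_indicator[symmetric] prod.distrib[symmetric]
    by (intro prod.cong refl) (auto simp: w_def algebra_simps)
qed

text \<open>This is the left-hand side once row \<open>r\<close> has been evaluated at
  \<open>w r\<close>. The polynomial of \<open>I\<close> vanishes at \<open>w r\<close> unless
  \<open>\<sigma> r \<in> I\<close> is equivalent to \<open>b r\<close>, so at most one
  \<open>I\<close> contributes, and only when \<open>\<sigma>\<close> is a bijection.\<close>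

lemma sum_over_subset_weights:
  fixes x :: "nat \<Rightarrow> 'a::field" and t :: 'a and b :: "nat \<Rightarrow> bool"
  assumes x: "inj_on x {1..n}" and \<sigma>: "\<And>r. r < n \<Longrightarrow> \<sigma> r \<in> {1..n}"
  defines "w \<equiv> \<lambda>r. (if b r then t else 1) * x (\<sigma> r)"
  shows "t ^ (k choose 2) * (\<Sum>I | I \<subseteq> {1..n} \<and> card I = k.
      (\<Prod>i\<in>I. \<Prod>j\<in>{1..n} - I. t * x i - x j) / (\<Prod>i\<in>I. \<Prod>j\<in>{1..n} - I. x i - x j) *
      ((\<Prod>r<n. poly (mixed_poly n x t I) (w r)) * det (mat n n (\<lambda>(r, c). w r ^ c)))) =
    (if card {r. r < n \<and> b r} = k
     then t ^ (k * (n - 1)) * (\<Prod>r<n. poly (mixed_poly n x t (if b r then {1..n} else {})) (w r)) *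
       det (mat n n (\<lambda>(r, c). x (\<sigma> r) ^ c))
     else 0)"
    (is "_ * sum ?g ?F = ?rhs")
proof (cases "inj_on \<sigma> {..<n}")
  \<comment> \<open>If a letter is used twice, equal marks give two equal rows, while different
    marks put both \<open>x i\<close> and \<open>t * x i\<close> among the nodes, and one of them is
    a root of the polynomial of any \<open>I\<close>.\<close>
  case False
  then obtain r s where rs: "r < n" "s < n" "r \<noteq> s" "\<sigma> r = \<sigma> s" by (auto simp: inj_on_def)
  then have 1: "det (mat n n (\<lambda>(r, c). x (\<sigma> r) ^ c)) = 0"
    by (intro det_equal_rows[of r n s]) auto
  have "?g I = 0" if I: "I \<in> ?F" for I
  proof (cases "b r = b s")
    case True
    with rs have "det (mat n n (\<lambda>(r, c). w r ^ c)) = 0"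
      by (intro det_equal_rows[of r n s]) (auto simp: w_def)
    then show ?thesis by simp
  next
    case False
    have "finite I" using I finite_subset[of I "{1..n}"] by auto
    have "poly (mixed_poly n x t I) (w r) = 0 \<or> poly (mixed_poly n x t I) (w s) = 0"
      using False rs \<sigma>[of r] \<open>finite I\<close> by (auto simp: poly_mixed_poly w_def)
    then have "(\<Prod>r<n. poly (mixed_poly n x t I) (w r)) = 0"
      using rs by (intro prod_zero) auto
    then show ?thesis by simp
  qed
  then have "sum ?g ?F = 0" by (intro sum.neutral) auto
  with 1 show ?thesis by simp
next
  case True
  have "\<sigma> ` {..<n} \<subseteq> {1..n}" using \<sigma> by auto
  moreover have "card (\<sigma> ` {..<n}) = card {1..n}" using True by (simp add: card_image)
  ultimately have "\<sigma> ` {..<n} = {1..n}" by (intro card_subset_eq) auto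
  with True have bij: "bij_betw \<sigma> {..<n} {1..n}" by (simp add: bij_betw_def)
  define J where "J = \<sigma> ` {r. r < n \<and> b r}"
  have J: "J \<subseteq> {1..n}" "finite J" using \<sigma> by (auto simp: J_def)
  have memJ: "\<sigma> r \<in> J \<longleftrightarrow> b r" if "r < n" for r
    using True that by (auto simp: J_def inj_on_def)
  have cardJ: "card J = card {r. r < n \<and> b r}"
    unfolding J_def by (intro card_image inj_on_subset[OF True]) auto
  have "?g I = 0" if I: "I \<in> ?F" "I \<noteq> J" for I
  proof -
    have fin: "finite I" using I finite_subset[of I "{1..n}"] by auto
    from I J(1) obtain i where i: "i \<in> {1..n}" "(i \<in> I) \<noteq> (i \<in> J)" by blast
    then have "i \<in> \<sigma> ` {..<n}" using \<open>\<sigma> ` {..<n} = {1..n}\<close> by simp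
    then obtain r where r: "r < n" "\<sigma> r = i" by auto
    have "poly (mixed_poly n x t I) (w r) = 0"
      using i r memJ[of r] fin by (auto simp: poly_mixed_poly w_def)
    then have "(\<Prod>r<n. poly (mixed_poly n x t I) (w r)) = 0"
      using r by (intro prod_zero) auto
    then show ?thesis by simp
  qed
  then have "sum ?g ?F = (\<Sum>I\<in>?F. if I = J then ?g J else 0)"
    by (intro sum.cong) auto
  also have "\<dots> = (if card J = k then ?g J else 0)" using J by auto
  finally have lhs: "sum ?g ?F = (if card J = k then ?g J else 0)" .
  define K where "K = {1..n} - J"
  have JK: "J \<union> K = {1..n}" "J \<inter> K = {}" "finite K" using J by (auto simp: K_def)
  \<comment> \<open>\<open>U\<close> and \<open>V\<close> are the denominator and numerator of the
    weight of \<open>J\<close>, \<open>e\<close> is the sign from reversing all differences between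
    \<open>J\<close> and \<open>K\<close>, and \<open>C\<close> collects the factors inside
    \<open>J\<close> and inside \<open>K\<close>, which both evaluations below share.\<close>
  define U where "U = (\<Prod>i\<in>J. \<Prod>j\<in>K. x i - x j)"
  define V where "V = (\<Prod>i\<in>J. \<Prod>j\<in>K. t * x i - x j)"
  define e :: 'a where "e = (\<Prod>i\<in>J. \<Prod>j\<in>K. -1)"
  define C where "C = (\<Prod>j\<in>K. \<Prod>l\<in>K. x j - t * x l) * (\<Prod>i\<in>J. \<Prod>l\<in>J. t * x i - x l)"
  have U0: "U \<noteq> 0"
    using x J by (auto simp: U_def K_def inj_on_def)
  have flip: "(\<Prod>j\<in>K. \<Prod>i\<in>J. - h i j) = e * (\<Prod>i\<in>J. \<Prod>j\<in>K. h i j)" for h :: "nat \<Rightarrow> nat \<Rightarrow> 'a"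
    unfolding e_def by (subst prod.swap) (simp only: prod.distrib[symmetric] mult_minus1)
  have rows: "(\<Prod>r<n. if b r then G (\<sigma> r) else H (\<sigma> r)) = (\<Prod>i\<in>J. G i) * (\<Prod>j\<in>K. H j)"
    for G H :: "nat \<Rightarrow> 'a"
  proof -
    have "(\<Prod>r<n. if b r then G (\<sigma> r) else H (\<sigma> r)) = (\<Prod>r<n. if \<sigma> r \<in> J then G (\<sigma> r) else H (\<sigma> r))"
      using memJ by (intro prod.cong) auto
    also have "\<dots> = (\<Prod>i\<in>{1..n}. if i \<in> J then G i else H i)"
      by (rule prod.reindex_bij_betw[OF bij])
    also have "\<dots> = (\<Prod>i\<in>J. G i) * (\<Prod>j\<in>K. H j)"
    proof -
      have "{1..n} \<inter> {i. i \<in> J} = J" "{1..n} \<inter> - {i. i \<in> J} = K" using J by (auto simp: K_def)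
      then show ?thesis by (simp only: prod.If_cases finite_atLeastAtMost)
    qed
    finally show ?thesis .
  qed
  \<comment> \<open>The cross factors are \<open>t * x i - t * x j\<close> at the scaled nodes,
    whence the power of \<open>t\<close>, and \<open>x j - x i\<close> at the unscaled ones, whence
    \<open>e\<close>.\<close>
  have A: "(\<Prod>r<n. poly (mixed_poly n x t J) (w r)) = t ^ (card J * card K) * e * U * U * C"
  proof -
    have "(\<Prod>r<n. poly (mixed_poly n x t J) (w r)) =
        (\<Prod>r<n. if b r then poly (mixed_poly n x t J) (t * x (\<sigma> r)) else poly (mixed_poly n x t J) (x (\<sigma> r)))"
      by (intro prod.cong) (auto simp: w_def)
    also have "\<dots> = (\<Prod>i\<in>J. poly (mixed_poly n x t J) (t * x i)) * (\<Prod>j\<in>K. poly (mixed_poly n x t J) (x j))"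
      by (rule rows)
    also have "(\<Prod>i\<in>J. poly (mixed_poly n x t J) (t * x i)) =
        (\<Prod>i\<in>J. \<Prod>l\<in>J. t * x i - x l) * (t ^ (card J * card K) * U)"
      unfolding poly_mixed_poly K_def[symmetric] U_def
      by (simp only: right_diff_distrib[symmetric] prod.distrib prod_constant
          power_mult[symmetric] mult.commute[of "card K"])
    also have "(\<Prod>j\<in>K. poly (mixed_poly n x t J) (x j)) =
        e * U * (\<Prod>j\<in>K. \<Prod>l\<in>K. x j - t * x l)"
      unfolding poly_mixed_poly K_def[symmetric] U_def flip[symmetric]
      by (simp add: prod.distrib)
    finally show ?thesis by (simp add: C_def mult_ac)
  qed
  \<comment> \<open>For the extreme polynomials the cross factors are \<open>t * x i - x j\<close>
    and \<open>x j - t * x i\<close>, so \<open>V\<close> takes the place of \<open>U\<close> and no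
    power of \<open>t\<close> appears.\<close>
  have B: "(\<Prod>r<n. poly (mixed_poly n x t (if b r then {1..n} else {})) (w r)) = e * V * V * C"
  proof -
    have split: "(\<Prod>i = 1..n. h i) = (\<Prod>i\<in>J. h i) * (\<Prod>i\<in>K. h i)" for h :: "nat \<Rightarrow> 'a"
      using JK J by (subst JK(1)[symmetric], subst prod.union_disjoint) auto
    have "(\<Prod>r<n. poly (mixed_poly n x t (if b r then {1..n} else {})) (w r)) =
        (\<Prod>r<n. if b r then \<Prod>i = 1..n. t * x (\<sigma> r) - x i else \<Prod>i = 1..n. x (\<sigma> r) - t * x i)"
      by (intro prod.cong) (auto simp: w_def poly_mixed_poly)
    also have "\<dots> = (\<Prod>i\<in>J. \<Prod>l = 1..n. t * x i - x l) * (\<Prod>j\<in>K. \<Prod>l = 1..n. x j - t * x l)"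
      by (rule rows)
    also have "(\<Prod>i\<in>J. \<Prod>l = 1..n. t * x i - x l) = (\<Prod>i\<in>J. \<Prod>l\<in>J. t * x i - x l) * V"
      unfolding split prod.distrib V_def ..
    also have "(\<Prod>j\<in>K. \<Prod>l = 1..n. x j - t * x l) = e * V * (\<Prod>j\<in>K. \<Prod>l\<in>K. x j - t * x l)"
      unfolding V_def flip[symmetric] split prod.distrib by simp
    finally show ?thesis by (simp add: C_def mult_ac)
  qed
  have D: "det (mat n n (\<lambda>(r, c). w r ^ c)) * U =
      t ^ (card J choose 2) * det (mat n n (\<lambda>(r, c). x (\<sigma> r) ^ c)) * V"
    using vandermonde_scaled_nodes[OF bij, of b t x] unfolding U_def V_def K_def J_def w_def .
  \<comment> \<open>The three exponents come from the prefactor of the operator, from the scaled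
    Vandermonde determinant in \<open>D\<close>, and from \<open>A\<close>.\<close>
  have E: "(card J choose 2) + (card J choose 2) + card J * card K = card J * (n - 1)"
  proof -
    have "n = card J + card K" using JK J by (metis card_Un_disjoint card_atLeastAtMost diff_Suc_1)
    moreover have "(m choose 2) + (m choose 2) = m * (m - 1)" for m :: nat
    proof -
      have "even (m * (m - 1))" by (cases m) auto
      then show ?thesis by (simp add: choose_two flip: mult_2)
    qed
    moreover have "l * (l - 1) + l * m = l * (l + m - 1)" for l m :: nat
      by (cases l) (auto simp: algebra_simps)
    ultimately show ?thesis by simp
  qed
  have "t ^ (card J choose 2) * ?g J =
      t ^ (card J * (n - 1)) * (e * V * V * C) * det (mat n n (\<lambda>(r, c). x (\<sigma> r) ^ c))"
  proof -
    have cancel: "V / U * (T * e * U * U * C * d) = V * T * e * C * (d * U)" for T d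
      using U0 by (simp add: field_simps)
    have "t ^ (card J choose 2) * ?g J = t ^ (card J choose 2) * (V / U *
        (t ^ (card J * card K) * e * U * U * C * det (mat n n (\<lambda>(r, c). w r ^ c))))"
      unfolding A U_def V_def K_def by (rule refl)
    also have "\<dots> = t ^ (card J choose 2) * V * t ^ (card J * card K) * e * C *
        (det (mat n n (\<lambda>(r, c). w r ^ c)) * U)"
      unfolding cancel by (simp only: mult.assoc)
    finally show ?thesis unfolding D E[symmetric] power_add by (simp add: mult_ac)
  qed
  then show ?thesis unfolding lhs B by (auto simp: cardJ)
qed

section \<open>From moment functionals to evaluations at nodes\<close>

lemma degree_mixed_poly_le:
  assumes "I \<subseteq> {1..n}"
  shows "degree (mixed_poly n x t I) \<le> n"
proof -
  have fin: "finite I" using assms finite_subset by blast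
  have "degree (mixed_poly n x t I) \<le>
      degree (\<Prod>i\<in>I. [:- x i, 1:]) + degree (\<Prod>j\<in>{1..n} - I. [:- (t * x j), 1:])"
    unfolding mixed_poly_def by (rule degree_mult_le)
  also have "\<dots> \<le> sum (degree \<circ> (\<lambda>i. [:- x i, 1:])) I + sum (degree \<circ> (\<lambda>j. [:- (t * x j), 1:])) ({1..n} - I)"
    by (intro add_mono degree_prod_sum_le fin) auto
  also have "\<dots> \<le> (\<Sum>i\<in>I. 1) + (\<Sum>i\<in>{1..n} - I. 1)"
    by (intro add_mono sum_mono) auto
  also have "\<dots> = card I + card ({1..n} - I)" by simp
  also have "\<dots> = n" using assms fin card_mono[OF _ assms] by (simp add: card_Diff_subset)
  finally show ?thesis .
qed

lemma poly_eq_sum_lessThan: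
  fixes p :: "'a::comm_semiring_1 poly"
  assumes "degree p < m"
  shows "poly p y = (\<Sum>d<m. coeff p d * y ^ d)"
  unfolding poly_altdef
  by (rule sum.mono_neutral_left) (use assms in \<open>auto simp: coeff_eq_0\<close>)

text \<open>The symmetric functions enter only through the moments \<open>\<gamma> r\<close>, which
  are arbitrary here. The hypotheses on \<open>x\<close> and \<open>t\<close> make the
  \<open>2 * n\<close> nodes \<open>x i\<close> and \<open>t * x i\<close> distinct, as many as
  there are moments in each row.\<close>

lemma det_moment_identity:
  fixes x :: "nat \<Rightarrow> 'a::field" and \<gamma> :: "nat \<Rightarrow> nat \<Rightarrow> 'a"
  assumes x: "inj_on x {1..n}" and t: "t \<noteq> 0"
    and tx: "\<And>i j. i \<in> {1..n} \<Longrightarrow> j \<in> {1..n} \<Longrightarrow> t * x i \<noteq> x j"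
  defines "ev \<equiv> \<lambda>r p. \<Sum>d<2 * n. coeff p d * \<gamma> r d"
  shows "t ^ (k choose 2) * (\<Sum>I | I \<subseteq> {1..n} \<and> card I = k.
      (\<Prod>i\<in>I. \<Prod>j\<in>{1..n} - I. t * x i - x j) / (\<Prod>i\<in>I. \<Prod>j\<in>{1..n} - I. x i - x j) *
      det (mat n n (\<lambda>(r, c). ev r (monom 1 c * mixed_poly n x t I)))) =
    (\<Sum>I | I \<subseteq> {1..n} \<and> card I = k. t ^ (\<Sum>i\<in>I. n - i) *
      det (mat n n (\<lambda>(r, c). ev r (monom 1 c * mixed_poly n x t (if c + 1 \<in> I then {1..n} else {})))))"
proof -
  define S where "S = {1..n} \<times> (UNIV :: bool set)"
  define node where "node = (\<lambda>(i, b). (if b then t else 1) * x i)"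
  have fin: "finite S" by (simp add: S_def)
  have card: "card S = 2 * n" by (simp add: S_def card_cartesian_product)
  have "inj_on node S"
  proof (rule inj_onI)
    fix u v assume "u \<in> S" "v \<in> S" and eq: "node u = node v"
    then obtain i b j b' where [simp]: "u = (i, b)" "v = (j, b')"
      and ij: "i \<in> {1..n}" "j \<in> {1..n}" by (auto simp: S_def)
    show "u = v"
    proof (cases "b = b'")
      case True
      then have "x i = x j" using eq t by (simp add: node_def split: if_splits)
      then show ?thesis using True inj_onD[OF x _ ij] by simp
    next
      case False
      then show ?thesis using eq tx[OF ij] tx[OF ij(2,1)] by (simp add: node_def split: if_splits)
    qed
  qed
  have "\<exists>\<alpha>. \<forall>d<2 * n. \<gamma> r d = (\<Sum>s\<in>S. \<alpha> s * node s ^ d)" for r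
    by (rule vandermonde_system_solvable[OF fin \<open>inj_on node S\<close>, of "\<gamma> r"]) (auto simp: card)
  then obtain \<alpha> where \<alpha>: "\<And>r d. d < 2 * n \<Longrightarrow> \<gamma> r d = (\<Sum>s\<in>S. \<alpha> r s * node s ^ d)"
    by metis
  have ev: "ev r p = (\<Sum>s\<in>S. \<alpha> r s * poly p (node s))" if "degree p < 2 * n" for r p
  proof -
    have "ev r p = (\<Sum>d<2 * n. \<Sum>s\<in>S. coeff p d * (\<alpha> r s * node s ^ d))"
      by (simp add: ev_def \<alpha> sum_distrib_left)
    also have "\<dots> = (\<Sum>s\<in>S. \<Sum>d<2 * n. coeff p d * (\<alpha> r s * node s ^ d))"
      by (rule sum.swap)
    also have "\<dots> = (\<Sum>s\<in>S. \<alpha> r s * poly p (node s))"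
      by (simp add: poly_eq_sum_lessThan[OF that] sum_distrib_left mult_ac)
    finally show ?thesis .
  qed
  define F where "F = {I. I \<subseteq> {1..n} \<and> card I = k}"
  define N where "N = PiE {0..<n} (\<lambda>_. S)"
  define a where "a f = (\<Prod>r = 0..<n. \<alpha> r (f r))" for f
  \<comment> \<open>\<open>J\<close> may depend on the column, so one expansion serves both the
    left-hand side, where it is constant, and the right-hand side, where it switches between two
    sets. Interpolation applies because \<open>c + n < 2 * n\<close>.\<close>
  have det_ev: "det (mat n n (\<lambda>(r, c). ev r (monom 1 c * mixed_poly n x t (J c)))) =
      (\<Sum>f\<in>N. a f * det (mat n n (\<lambda>(r, c). poly (mixed_poly n x t (J c)) (node (f r)) * node (f r) ^ c)))"
    if "\<And>c. J c \<subseteq> {1..n}" for J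
  proof -
    have "mat n n (\<lambda>(r, c). ev r (monom 1 c * mixed_poly n x t (J c))) =
        mat n n (\<lambda>(r, c). \<Sum>s\<in>S. \<alpha> r s * (poly (mixed_poly n x t (J c)) (node s) * node s ^ c))"
    proof (rule cong_mat[OF refl refl], unfold prod.case)
      fix r c assume "r < n" "c < n"
      have "degree (monom 1 c * mixed_poly n x t (J c)) \<le> c + n"
        using degree_mult_le[of "monom 1 c" "mixed_poly n x t (J c)"]
          degree_mixed_poly_le[OF that[of c], of x t] degree_monom_le[of "1::'a" c] by linarith
      also have "\<dots> < 2 * n" using \<open>c < n\<close> by simp
      finally show "ev r (monom 1 c * mixed_poly n x t (J c)) =
          (\<Sum>s\<in>S. \<alpha> r s * (poly (mixed_poly n x t (J c)) (node s) * node s ^ c))"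
        by (simp add: ev poly_monom mult.commute)
    qed
    then show ?thesis
      using det_rows_combination[OF fin, of n \<alpha>] by (simp add: N_def a_def)
  qed
  have pointwise: "t ^ (k choose 2) * (\<Sum>I\<in>F.
      (\<Prod>i\<in>I. \<Prod>j\<in>{1..n} - I. t * x i - x j) / (\<Prod>i\<in>I. \<Prod>j\<in>{1..n} - I. x i - x j) *
      det (mat n n (\<lambda>(r, c). poly (mixed_poly n x t I) (node (f r)) * node (f r) ^ c))) =
    (\<Sum>I\<in>F. t ^ (\<Sum>i\<in>I. n - i) * det (mat n n (\<lambda>(r, c).
      poly (mixed_poly n x t (if c + 1 \<in> I then {1..n} else {})) (node (f r)) * node (f r) ^ c)))"
    if f: "f \<in> N" for f
  proof -
    define \<sigma> where "\<sigma> = fst \<circ> f"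
    define b where "b = snd \<circ> f"
    define y where "y r = poly (mixed_poly n x t (if b r then {1..n} else {})) (node (f r))" for r
    have node: "node (f r) = (if b r then t else 1) * x (\<sigma> r)" for r
      by (simp add: node_def \<sigma>_def b_def split: prod.splits)
    have \<sigma>: "\<sigma> r \<in> {1..n}" if "r < n" for r
    proof -
      have "f r \<in> S" using f that by (auto simp: N_def PiE_def Pi_def)
      then show ?thesis by (auto simp: S_def \<sigma>_def)
    qed
    \<comment> \<open>The polynomial of \<open>{1..n}\<close> vanishes at every \<open>x i\<close>
      and that of \<open>{}\<close> at every \<open>t * x i\<close>, so marked rows are supported in
      the columns of \<open>I\<close> and unmarked rows in the others.\<close>
    have entries: "mat n n (\<lambda>(r, c). poly (mixed_poly n x t (if c + 1 \<in> I then {1..n} else {})) (node (f r)) * node (f r) ^ c) =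
        mat n n (\<lambda>(r, c). if b r = (c + 1 \<in> I) then y r * node (f r) ^ c else 0)" for I
    proof (rule cong_mat[OF refl refl], unfold prod.case)
      fix r c assume "r < n"
      show "poly (mixed_poly n x t (if c + 1 \<in> I then {1..n} else {})) (node (f r)) * node (f r) ^ c =
          (if b r = (c + 1 \<in> I) then y r * node (f r) ^ c else 0)"
        using \<sigma>[OF \<open>r < n\<close>] by (auto simp: y_def node poly_mixed_poly)
    qed
    have "(\<Sum>I\<in>F. t ^ (\<Sum>i\<in>I. n - i) * det (mat n n (\<lambda>(r, c).
        if b r = (c + 1 \<in> I) then y r * node (f r) ^ c else 0))) =
      (if card {r. r < n \<and> b r} = k
       then t ^ (k * (n - 1)) * (\<Prod>r<n. y r) * det (mat n n (\<lambda>(r, c). x (\<sigma> r) ^ c)) else 0)"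
      unfolding F_def node by (rule sum_over_column_choices)
    also have "\<dots> = t ^ (k choose 2) * (\<Sum>I\<in>F.
      (\<Prod>i\<in>I. \<Prod>j\<in>{1..n} - I. t * x i - x j) / (\<Prod>i\<in>I. \<Prod>j\<in>{1..n} - I. x i - x j) *
      det (mat n n (\<lambda>(r, c). poly (mixed_poly n x t I) (node (f r)) * node (f r) ^ c)))"
      unfolding F_def node y_def det_scale_rows
      by (rule sum_over_subset_weights[OF x \<sigma>, symmetric])
    finally show ?thesis unfolding entries ..
  qed
  have "t ^ (k choose 2) * (\<Sum>I\<in>F.
      (\<Prod>i\<in>I. \<Prod>j\<in>{1..n} - I. t * x i - x j) / (\<Prod>i\<in>I. \<Prod>j\<in>{1..n} - I. x i - x j) *
      det (mat n n (\<lambda>(r, c). ev r (monom 1 c * mixed_poly n x t I)))) =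
    (\<Sum>f\<in>N. a f * (t ^ (k choose 2) * (\<Sum>I\<in>F.
      (\<Prod>i\<in>I. \<Prod>j\<in>{1..n} - I. t * x i - x j) / (\<Prod>i\<in>I. \<Prod>j\<in>{1..n} - I. x i - x j) *
      det (mat n n (\<lambda>(r, c). poly (mixed_poly n x t I) (node (f r)) * node (f r) ^ c)))))"
    (is "_ * (\<Sum>I\<in>F. ?q I * _) = _")
  proof -
    have "(\<Sum>I\<in>F. ?q I * det (mat n n (\<lambda>(r, c). ev r (monom 1 c * mixed_poly n x t I)))) =
        (\<Sum>I\<in>F. \<Sum>f\<in>N. a f * (?q I * det (mat n n (\<lambda>(r, c). poly (mixed_poly n x t I) (node (f r)) * node (f r) ^ c))))"
    proof (rule sum.cong[OF refl])
      fix I assume "I \<in> F"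
      then have "I \<subseteq> {1..n}" by (simp add: F_def)
      show "?q I * det (mat n n (\<lambda>(r, c). ev r (monom 1 c * mixed_poly n x t I))) =
          (\<Sum>f\<in>N. a f * (?q I * det (mat n n (\<lambda>(r, c). poly (mixed_poly n x t I) (node (f r)) * node (f r) ^ c))))"
        unfolding det_ev[of "\<lambda>_. I", OF \<open>I \<subseteq> {1..n}\<close>] by (simp only: sum_distrib_left mult.left_commute)
    qed
    also have "\<dots> = (\<Sum>f\<in>N. a f * (\<Sum>I\<in>F. ?q I * det (mat n n (\<lambda>(r, c). poly (mixed_poly n x t I) (node (f r)) * node (f r) ^ c))))"
      by (subst sum.swap) (simp only: sum_distrib_left)
    finally show ?thesis by (simp only: sum_distrib_left mult.left_commute)
  qed
  also have "\<dots> = (\<Sum>f\<in>N. a f * (\<Sum>I\<in>F. t ^ (\<Sum>i\<in>I. n - i) * det (mat n n (\<lambda>(r, c).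
      poly (mixed_poly n x t (if c + 1 \<in> I then {1..n} else {})) (node (f r)) * node (f r) ^ c))))"
    by (intro sum.cong refl) (simp only: pointwise)
  also have "\<dots> = (\<Sum>f\<in>N. \<Sum>I\<in>F. t ^ (\<Sum>i\<in>I. n - i) * (a f * det (mat n n (\<lambda>(r, c).
      poly (mixed_poly n x t (if c + 1 \<in> I then {1..n} else {})) (node (f r)) * node (f r) ^ c))))"
    by (simp only: sum_distrib_left mult.left_commute)
  also have "\<dots> = (\<Sum>I\<in>F. t ^ (\<Sum>i\<in>I. n - i) *
      det (mat n n (\<lambda>(r, c). ev r (monom 1 c * mixed_poly n x t (if c + 1 \<in> I then {1..n} else {})))))"
    unfolding sum.swap[of _ F] sum_distrib_left[symmetric]
    by (subst det_ev) auto
  finally show ?thesis unfolding F_def .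
qed

section \<open>Substitution into polynomials and rational functions\<close>

definition monom_value :: "(nat \<Rightarrow> 'a::comm_ring_1) \<Rightarrow> (nat \<Rightarrow>\<^sub>0 nat) \<Rightarrow> 'a" where
  "monom_value \<sigma> m = (\<Prod>v\<in>Poly_Mapping.keys m. \<sigma> v ^ Poly_Mapping.lookup m v)"

lemma monom_value_superset:
  assumes "finite V" "Poly_Mapping.keys m \<subseteq> V"
  shows "monom_value \<sigma> m = (\<Prod>v\<in>V. \<sigma> v ^ Poly_Mapping.lookup m v)"
  unfolding monom_value_def
  by (rule prod.mono_neutral_left) (use assms in \<open>auto simp: in_keys_iff\<close>)

lemma monom_value_0 [simp]: "monom_value \<sigma> 0 = 1"
  by (simp add: monom_value_def)

lemma monom_value_single [simp]: "monom_value \<sigma> (Poly_Mapping.single v e) = \<sigma> v ^ e"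
  by (cases "e = 0") (simp_all add: monom_value_def)

lemma monom_value_add: "monom_value \<sigma> (m + m') = monom_value \<sigma> m * monom_value \<sigma> m'"
proof -
  let ?V = "Poly_Mapping.keys m \<union> Poly_Mapping.keys m'"
  have "Poly_Mapping.keys (m + m') \<subseteq> ?V" by (rule keys_add)
  then show ?thesis
    by (simp add: monom_value_superset[of ?V] lookup_add power_add prod.distrib)
qed

lemma insertion_superset:
  assumes "h 0 = 0" "finite S" "Poly_Mapping.keys P \<subseteq> S"
  shows "insertion h \<sigma> P = (\<Sum>m\<in>S. h (Poly_Mapping.lookup P m) * monom_value \<sigma> m)"
  unfolding insertion_def monom_value_def[symmetric]
  by (rule sum.mono_neutral_left) (use assms in \<open>auto simp: in_keys_iff\<close>)

lemma insertion_single: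
  assumes "h 0 = 0"
  shows "insertion h \<sigma> (Poly_Mapping.single m a) = h a * monom_value \<sigma> m"
  using insertion_superset[of h "{m}" "Poly_Mapping.single m a" \<sigma>] assms by simp

lemma mpoly_sum_monomials:
  fixes P :: mpoly
  shows "P = (\<Sum>m\<in>Poly_Mapping.keys P. Poly_Mapping.single m (Poly_Mapping.lookup P m))"
proof (rule poly_mapping_eqI)
  fix k
  have "(\<Sum>m\<in>Poly_Mapping.keys P. Poly_Mapping.lookup P m when m = k) =
      (\<Sum>m\<in>Poly_Mapping.keys P. if m = k then Poly_Mapping.lookup P k else 0)"
    by (intro sum.cong) (auto simp: when_def)
  then show "Poly_Mapping.lookup P k =
      Poly_Mapping.lookup (\<Sum>m\<in>Poly_Mapping.keys P. Poly_Mapping.single m (Poly_Mapping.lookup P m)) k"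
    by (simp add: lookup_sum lookup_single in_keys_iff)
qed

lemma comm_ring_hom_insertion:
  assumes "comm_ring_hom h"
  shows "comm_ring_hom (insertion h \<sigma>)"
proof -
  interpret h: comm_ring_hom h by fact
  have add: "insertion h \<sigma> (P + Q) = insertion h \<sigma> P + insertion h \<sigma> Q" for P Q
  proof -
    let ?S = "Poly_Mapping.keys P \<union> Poly_Mapping.keys Q"
    have "Poly_Mapping.keys (P + Q) \<subseteq> ?S" by (rule keys_add)
    then show ?thesis
      by (simp add: insertion_superset[of h ?S] lookup_add h.hom_add ring_distribs sum.distrib)
  qed
  have zero: "insertion h \<sigma> 0 = 0" by (simp add: insertion_def)
  interpret comm_monoid_add_hom "insertion h \<sigma>"
    by unfold_locales (simp_all add: add zero)
  have "insertion h \<sigma> (P * Q) = insertion h \<sigma> P * insertion h \<sigma> Q" for P Q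
  proof -
    let ?s = "\<lambda>P m. Poly_Mapping.single m (Poly_Mapping.lookup P m) :: mpoly"
    have "P * Q = (\<Sum>m\<in>Poly_Mapping.keys P. ?s P m) * (\<Sum>m\<in>Poly_Mapping.keys Q. ?s Q m)"
      using mpoly_sum_monomials by metis
    also have "insertion h \<sigma> \<dots> = (\<Sum>m\<in>Poly_Mapping.keys P. \<Sum>m'\<in>Poly_Mapping.keys Q.
        (h (Poly_Mapping.lookup P m) * monom_value \<sigma> m) * (h (Poly_Mapping.lookup Q m') * monom_value \<sigma> m'))"
      by (simp add: sum_product hom_sum mult_single insertion_single monom_value_add h.hom_mult mult_ac)
    also have "\<dots> = insertion h \<sigma> P * insertion h \<sigma> Q"
      unfolding insertion_def monom_value_def[symmetric] sum_product ..
    finally show ?thesis .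
  qed
  moreover have "insertion h \<sigma> 1 = 1"
    using insertion_single[of h \<sigma> 0 1] by (simp add: h.hom_one)
  ultimately show ?thesis by unfold_locales (simp_all add: add zero)
qed

lemma hom_insertion:
  assumes "comm_ring_hom \<phi>"
  shows "\<phi> (insertion h \<sigma> P) = insertion (\<lambda>a. \<phi> (h a)) (\<lambda>v. \<phi> (\<sigma> v)) P"
proof -
  interpret comm_ring_hom \<phi> by fact
  show ?thesis by (simp add: insertion_def hom_distribs)
qed

lemma insertion_cong:
  assumes "\<And>m v. m \<in> Poly_Mapping.keys P \<Longrightarrow> v \<in> Poly_Mapping.keys m \<Longrightarrow> \<sigma> v = \<tau> v"
  shows "insertion h \<sigma> P = insertion h \<tau> P"
  unfolding insertion_def using assms by (intro sum.cong arg_cong2[of _ _ _ _ "(*)"] prod.cong refl) auto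

lemma insertion_const:
  assumes "comm_ring_hom h"
  shows "insertion h \<sigma> (const a) = h a"
proof -
  interpret comm_ring_hom h by fact
  show ?thesis by (simp add: const_def insertion_single)
qed

lemma insertion_pvar:
  assumes "comm_ring_hom h"
  shows "insertion h \<sigma> (pvar v) = \<sigma> v"
proof -
  interpret comm_ring_hom h by fact
  show ?thesis by (simp add: pvar_def insertion_single)
qed

lemma comm_ring_hom_const: "comm_ring_hom const"
  by unfold_locales (simp_all add: const_def single_add mult_single)

lemma comm_ring_hom_to_fract: "comm_ring_hom (to_fract :: 'a::idom \<Rightarrow> 'a fract)"
  by unfold_locales simp_all

interpretation const: comm_ring_hom const by (rule comm_ring_hom_const)
interpretation to_fract: comm_ring_hom "to_fract :: 'a::idom \<Rightarrow> 'a fract"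
  by (rule comm_ring_hom_to_fract)

lemma rconst_eq: "rconst a = to_fract (const a)"
  by (simp add: rconst_def to_fract_def)

lemma rvar_eq: "rvar v = to_fract (pvar v)"
  by (simp add: rvar_def to_fract_def)

lemma comm_ring_hom_rconst: "comm_ring_hom rconst"
  by unfold_locales (simp_all add: rconst_eq hom_distribs)

interpretation rconst: comm_ring_hom rconst by (rule comm_ring_hom_rconst)

lemma const_eq_0_iff [simp]: "const a = 0 \<longleftrightarrow> a = 0"
  unfolding const_def by (metis lookup_single_eq lookup_zero single_zero)

text \<open>Characteristic zero; it is what lets a power series be recovered from a first order
  differential equation.\<close>

lemma of_nat_ratfun_eq_0_iff [simp]: "(of_nat k :: ratfun) = 0 \<longleftrightarrow> k = 0"
proof -
  have "(of_nat k :: ratfun) = to_fract (const (of_nat k))"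
    using rconst.hom_of_nat[of k] by (simp only: rconst_eq)
  then show ?thesis by (simp only: to_fract_eq_0_iff const_eq_0_iff of_nat_eq_0_iff)
qed

lemma pvar_power: "pvar v ^ k = Poly_Mapping.single (Poly_Mapping.single v k) 1"
  by (induction k) (simp_all add: pvar_def mult_single flip: single_add)

lemma monom_value_pvar: "monom_value pvar m = Poly_Mapping.single m 1"
proof -
  have *: "(\<Prod>v\<in>V. Poly_Mapping.single (m' v) 1) = (Poly_Mapping.single (\<Sum>v\<in>V. m' v) 1 :: mpoly)"
    if "finite V" for V :: "nat set" and m'
    using that by (induction rule: finite_induct) (simp_all add: mult_single)
  have "(\<Sum>v\<in>Poly_Mapping.keys m. Poly_Mapping.single v (Poly_Mapping.lookup m v)) = m"
  proof (rule poly_mapping_eqI)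
    fix k
    have "(\<Sum>v\<in>Poly_Mapping.keys m. Poly_Mapping.lookup m v when v = k) =
        (\<Sum>v\<in>Poly_Mapping.keys m. if v = k then Poly_Mapping.lookup m k else 0)"
      by (intro sum.cong) (auto simp: when_def)
    then show "Poly_Mapping.lookup (\<Sum>v\<in>Poly_Mapping.keys m.
        Poly_Mapping.single v (Poly_Mapping.lookup m v)) k = Poly_Mapping.lookup m k"
      by (simp add: lookup_sum lookup_single in_keys_iff)
  qed
  then show ?thesis by (simp add: monom_value_def pvar_power *)
qed

lemma monom_value_rvar: "monom_value rvar m = to_fract (Poly_Mapping.single m 1)"
  unfolding monom_value_pvar[symmetric]
  by (simp add: monom_value_def rvar_eq hom_distribs)

text \<open>Guarantees that no nonzero denominator is sent to 0, which makes \<open>rsubst\<close> a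
  total ring homomorphism.\<close>

definition injective_subst :: "(nat \<Rightarrow> ratfun) \<Rightarrow> bool" where
  "injective_subst \<sigma> \<longleftrightarrow> (\<forall>P. insertion rconst \<sigma> P = 0 \<longrightarrow> P = 0)"

text \<open>Distinct monomials go to distinct monomials, so no terms can cancel. Both substitutions
  in use, raising all variables to a power and scaling one variable by another, are of this
  kind.\<close>

lemma injective_subst_monomials:
  assumes "inj g" and \<sigma>: "\<And>m. monom_value \<sigma> m = to_fract (Poly_Mapping.single (g m) 1)"
  shows "injective_subst \<sigma>"
  unfolding injective_subst_def
proof (intro allI impI)
  fix P :: mpoly
  assume P: "insertion rconst \<sigma> P = 0"
  have "insertion rconst \<sigma> P =
      to_fract (\<Sum>m\<in>Poly_Mapping.keys P. Poly_Mapping.single (g m) (Poly_Mapping.lookup P m))"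
    unfolding insertion_def monom_value_def[symmetric] \<sigma>
    by (simp add: rconst_eq const_def mult_single to_fract.hom_sum flip: to_fract_mult)
  with P have 0: "(\<Sum>m\<in>Poly_Mapping.keys P. Poly_Mapping.single (g m) (Poly_Mapping.lookup P m)) = 0"
    by (simp only: to_fract_eq_0_iff)
  have "Poly_Mapping.lookup P k = 0" for k
  proof -
    have "(\<Sum>m\<in>Poly_Mapping.keys P. Poly_Mapping.lookup P m when g m = g k) =
        (\<Sum>m\<in>Poly_Mapping.keys P. if m = k then Poly_Mapping.lookup P k else 0)"
      using \<open>inj g\<close> by (intro sum.cong) (auto simp: when_def inj_eq)
    then show ?thesis
      using arg_cong[OF 0, of "\<lambda>Q. Poly_Mapping.lookup Q (g k)"]
      by (simp add: lookup_sum lookup_single in_keys_iff split: if_splits)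
  qed
  then show "P = 0" by (intro poly_mapping_eqI) simp
qed

text \<open>Settles the definite description in \<open>rsubst\<close>: every representation with
  nonzero denominator is admissible, and cross multiplication shows that all of them give the same
  value.\<close>

lemma rsubst_Fract:
  assumes "injective_subst \<sigma>" "b \<noteq> 0"
  shows "rsubst \<sigma> (Fract a b) = insertion rconst \<sigma> a / insertion rconst \<sigma> b"
  unfolding rsubst_def
proof (rule the_equality)
  interpret ins: comm_ring_hom "insertion rconst \<sigma>"
    by (intro comm_ring_hom_insertion comm_ring_hom_rconst)
  have nz: "insertion rconst \<sigma> P \<noteq> 0" if "P \<noteq> 0" for P
    using assms(1) that unfolding injective_subst_def by blast
  show "\<exists>a' b'. b' \<noteq> 0 \<and> Fract a b = Fract a' b' \<and> insertion rconst \<sigma> b' \<noteq> 0 \<and>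
      insertion rconst \<sigma> a / insertion rconst \<sigma> b = insertion rconst \<sigma> a' / insertion rconst \<sigma> b'"
    using assms(2) nz by blast
  fix F
  assume "\<exists>a' b'. b' \<noteq> 0 \<and> Fract a b = Fract a' b' \<and> insertion rconst \<sigma> b' \<noteq> 0 \<and>
      F = insertion rconst \<sigma> a' / insertion rconst \<sigma> b'"
  then obtain a' b' where b': "b' \<noteq> 0" and eq: "Fract a b = Fract a' b'"
    and F: "F = insertion rconst \<sigma> a' / insertion rconst \<sigma> b'" by blast
  have "a * b' = a' * b" using eq b' assms(2) by (simp add: eq_fract)
  then have "insertion rconst \<sigma> a * insertion rconst \<sigma> b' = insertion rconst \<sigma> a' * insertion rconst \<sigma> b"
    by (metis ins.hom_mult)
  then show "F = insertion rconst \<sigma> a / insertion rconst \<sigma> b"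
    unfolding F using nz[OF b'] nz[OF assms(2)] by (simp add: field_simps)
qed

lemma rsubst_to_fract:
  assumes "injective_subst \<sigma>"
  shows "rsubst \<sigma> (to_fract P) = insertion rconst \<sigma> P"
proof -
  interpret ins: comm_ring_hom "insertion rconst \<sigma>"
    by (intro comm_ring_hom_insertion comm_ring_hom_rconst)
  show ?thesis using rsubst_Fract[OF assms, of 1 P] by (simp add: to_fract_def)
qed

lemma comm_ring_hom_rsubst:
  assumes "injective_subst \<sigma>"
  shows "comm_ring_hom (rsubst \<sigma>)"
proof -
  interpret ins: comm_ring_hom "insertion rconst \<sigma>"
    by (intro comm_ring_hom_insertion comm_ring_hom_rconst)
  have nz: "insertion rconst \<sigma> P \<noteq> 0" if "P \<noteq> 0" for P
    using assms that unfolding injective_subst_def by blast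
  show ?thesis
  proof
    show "rsubst \<sigma> (E + F) = rsubst \<sigma> E + rsubst \<sigma> F" for E F
      by (cases E; cases F) (simp add: rsubst_Fract[OF assms] nz hom_distribs field_simps)
    show "rsubst \<sigma> (E * F) = rsubst \<sigma> E * rsubst \<sigma> F" for E F
      by (cases E; cases F) (simp add: rsubst_Fract[OF assms] nz hom_distribs)
    show "rsubst \<sigma> 0 = 0" "rsubst \<sigma> 1 = 1"
      using rsubst_to_fract[OF assms, of 0] rsubst_to_fract[OF assms, of 1] by simp_all
  qed
qed

lemma rsubst_divide:
  assumes "injective_subst \<sigma>"
  shows "rsubst \<sigma> (E / F) = rsubst \<sigma> E / rsubst \<sigma> F"
proof (cases "F = 0")
  case False
  interpret comm_ring_hom "rsubst \<sigma>" by (rule comm_ring_hom_rsubst[OF assms])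
  have 1: "rsubst \<sigma> (E / F) * rsubst \<sigma> F = rsubst \<sigma> E"
    using False by (simp flip: hom_mult)
  have "rsubst \<sigma> (1 / F) * rsubst \<sigma> F = 1"
    using False by (simp flip: hom_mult)
  then have "rsubst \<sigma> F \<noteq> 0" by auto
  with 1 show ?thesis by (simp add: field_simps)
next
  case True
  interpret comm_ring_hom "rsubst \<sigma>" by (rule comm_ring_hom_rsubst[OF assms])
  show ?thesis using True by simp
qed

lemma rsubst_rvar:
  assumes "injective_subst \<sigma>"
  shows "rsubst \<sigma> (rvar v) = \<sigma> v"
  by (simp add: rvar_eq rsubst_to_fract[OF assms] insertion_pvar[OF comm_ring_hom_rconst])

lemma rsubst_rconst:
  assumes "injective_subst \<sigma>"
  shows "rsubst \<sigma> (rconst a) = rconst a"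
  by (simp add: rconst_eq[of a] rsubst_to_fract[OF assms] insertion_const[OF comm_ring_hom_rconst])

lemma injective_subst_power:
  assumes "0 < i"
  shows "injective_subst (\<lambda>v. rvar v ^ i)"
proof (rule injective_subst_monomials)
  let ?g = "Poly_Mapping.map (\<lambda>e. i * e) :: (nat \<Rightarrow>\<^sub>0 nat) \<Rightarrow> (nat \<Rightarrow>\<^sub>0 nat)"
  have lookup: "Poly_Mapping.lookup (?g m) v = i * Poly_Mapping.lookup m v" for m v
    by (simp add: Poly_Mapping.map.rep_eq when_def)
  have keys: "Poly_Mapping.keys (?g m) = Poly_Mapping.keys m" for m
    using assms by (auto simp: in_keys_iff lookup)
  show "inj ?g"
  proof (rule injI)
    fix m m' assume "?g m = ?g m'"
    then have "i * Poly_Mapping.lookup m v = i * Poly_Mapping.lookup m' v" for v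
      using lookup by metis
    with assms show "m = m'" by (intro poly_mapping_eqI) simp
  qed
  show "monom_value (\<lambda>v. rvar v ^ i) m = to_fract (Poly_Mapping.single (?g m) 1)" for m
    unfolding monom_value_rvar[symmetric] by (simp add: monom_value_def keys lookup power_mult)
qed

text \<open>On exponent vectors the map adds the exponent of \<open>v\<close> to that of
  \<open>u\<close>. As \<open>u \<noteq> v\<close>, the exponent of \<open>v\<close> itself is
  unchanged, so the map can be undone.\<close>

lemma injective_subst_scale:
  assumes "u \<noteq> v"
  shows "injective_subst (rvar(v := rvar u * rvar v))"
proof (rule injective_subst_monomials)
  let ?g = "\<lambda>m :: nat \<Rightarrow>\<^sub>0 nat. m + Poly_Mapping.single u (Poly_Mapping.lookup m v)"
  show "inj ?g"
  proof (rule injI)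
    fix m m' assume eq: "?g m = ?g m'"
    from arg_cong[OF eq, of "\<lambda>m. Poly_Mapping.lookup m v"]
    have "Poly_Mapping.lookup m v = Poly_Mapping.lookup m' v"
      using assms by (simp add: lookup_add lookup_single when_def)
    with eq show "m = m'" by simp
  qed
  show "monom_value (rvar(v := rvar u * rvar v)) m = to_fract (Poly_Mapping.single (?g m) 1)" for m
  proof -
    let ?V = "insert v (Poly_Mapping.keys m)"
    have "monom_value (rvar(v := rvar u * rvar v)) m =
        (\<Prod>w\<in>?V. (if w = v then rvar u ^ Poly_Mapping.lookup m v else 1) * rvar w ^ Poly_Mapping.lookup m w)"
      by (subst monom_value_superset[of ?V]) (auto intro!: prod.cong simp: power_mult_distrib)
    also have "\<dots> = rvar u ^ Poly_Mapping.lookup m v * monom_value rvar m"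
    proof -
      have "monom_value rvar m = (\<Prod>w\<in>?V. rvar w ^ Poly_Mapping.lookup m w)"
        by (rule monom_value_superset) auto
      then show ?thesis unfolding prod.distrib by simp
    qed
    also have "\<dots> = monom_value rvar (?g m)"
      by (simp add: monom_value_add mult.commute)
    finally show ?thesis by (simp add: monom_value_rvar)
  qed
qed

section \<open>Power sums and complete symmetric functions\<close>

abbreviation real_eval :: "(nat \<Rightarrow> real) \<Rightarrow> mpoly \<Rightarrow> real" where
  "real_eval \<equiv> insertion (\<lambda>a. a)"

lemma comm_ring_hom_id: "comm_ring_hom (\<lambda>a :: 'a::comm_ring_1. a)"
  by unfold_locales simp_all

lemma comm_ring_hom_poly: "comm_ring_hom (\<lambda>p. poly p (y :: 'a::comm_ring_1))"
  by unfold_locales simp_all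

text \<open>Variables may coincide: taking \<open>k a\<close> of them equal to \<open>z a\<close>,
  block after block, realises the weighted power sums.\<close>

lemma real_eval_eq_0_on_nat_multiplicities:
  fixes n :: nat
  assumes P: "\<And>(N::nat) \<tau>. real_eval (\<lambda>i. \<Sum>v<N. \<tau> v ^ (i + 1)) P = 0"
  shows "real_eval (\<lambda>i. \<Sum>a<n. real (k a) * z a ^ (i + 1)) P = 0"
proof -
  have "\<exists>(N::nat) \<tau>. \<forall>i. (\<Sum>v<N. \<tau> v ^ (i + 1)) = (\<Sum>a<n. real (k a) * z a ^ (i + 1))"
  proof (induction n)
    case 0
    show ?case by (rule exI[of _ 0]) simp
  next
    case (Suc n)
    then obtain N :: nat and \<tau> where
      "\<forall>i. (\<Sum>v<N. \<tau> v ^ (i + 1)) = (\<Sum>a<n. real (k a) * z a ^ (i + 1))"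
      by (elim exE) (rule that)
    then have \<tau>: "(\<Sum>v<N. \<tau> v ^ (i + 1)) = (\<Sum>a<n. real (k a) * z a ^ (i + 1))" for i
      by (rule spec)
    have "(\<Sum>v<N + k n. (if v < N then \<tau> v else z n) ^ (i + 1)) =
        (\<Sum>a<Suc n. real (k a) * z a ^ (i + 1))" for i
    proof -
      have "(\<Sum>v<N + k n. (if v < N then \<tau> v else z n) ^ (i + 1)) =
          (\<Sum>v<N. (if v < N then \<tau> v else z n) ^ (i + 1)) +
          (\<Sum>v = N..<N + k n. (if v < N then \<tau> v else z n) ^ (i + 1))"
        unfolding lessThan_atLeast0 by (rule sum.atLeastLessThan_concat[symmetric]) auto
      also have "\<dots> = (\<Sum>v<N. \<tau> v ^ (i + 1)) + (\<Sum>v = N..<N + k n. z n ^ (i + 1))"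
        by (intro arg_cong2[of _ _ _ _ "(+)"] sum.cong) auto
      finally show ?thesis unfolding \<tau> by simp
    qed
    then show ?case by (intro exI allI)
  qed
  then obtain N :: nat and \<tau> where
    "\<forall>i. (\<Sum>v<N. \<tau> v ^ (i + 1)) = (\<Sum>a<n. real (k a) * z a ^ (i + 1))"
    by (elim exE) (rule that)
  then have "(\<lambda>i. \<Sum>a<n. real (k a) * z a ^ (i + 1)) = (\<lambda>i. \<Sum>v<N. \<tau> v ^ (i + 1))" by simp
  then show ?thesis by (simp only: P)
qed

text \<open>Passes from natural to real weights one coordinate at a time: as a polynomial in a
  single weight, the value vanishes at all naturals and hence everywhere.\<close>

lemma real_eval_eq_0_on_real_multiplicities:
  fixes n :: nat
  assumes P: "\<And>(N::nat) \<tau>. real_eval (\<lambda>i. \<Sum>v<N. \<tau> v ^ (i + 1)) P = 0"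
  shows "real_eval (\<lambda>i. \<Sum>a<n. y a * z a ^ (i + 1)) P = 0"
proof -
  \<comment> \<open>Only the weights before position \<open>m\<close> may be arbitrary reals; the
    induction moves this boundary.\<close>
  have "real_eval (\<lambda>i. \<Sum>a<n. y a * z a ^ (i + 1)) P = 0"
    if "m \<le> n" "\<And>a. m \<le> a \<Longrightarrow> a < n \<Longrightarrow> y a \<in> \<nat>" for m y
    using that
  proof (induction m arbitrary: y)
    case 0
    then have "\<forall>a\<in>{..<n}. \<exists>k. y a = real k" by (auto simp: Nats_def)
    then obtain k where "\<And>a. a < n \<Longrightarrow> y a = real (k a)"
      using bchoice[of "{..<n}" "\<lambda>a k. y a = real k"] by auto
    then have "(\<lambda>i. \<Sum>a<n. y a * z a ^ (i + 1)) = (\<lambda>i. \<Sum>a<n. real (k a) * z a ^ (i + 1))"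
      by (intro ext sum.cong) auto
    then show ?case using real_eval_eq_0_on_nat_multiplicities[OF P] by simp
  next
    case (Suc m)
    define rest where "rest i = (\<Sum>a\<in>{..<n} - {m}. y a * z a ^ (i + 1))" for i
    \<comment> \<open>\<open>Q\<close> treats the weight at \<open>m\<close> as the indeterminate;
      evaluation at \<open>u\<close> replaces that weight by \<open>u\<close>.\<close>
    define Q where "Q = insertion (\<lambda>a. [:a:]) (\<lambda>i. [:rest i, z m ^ (i + 1):]) P"
    have Q: "poly Q u = real_eval (\<lambda>i. \<Sum>a<n. (y(m := u)) a * z a ^ (i + 1)) P" for u
    proof -
      have "(\<Sum>a<n. (y(m := u)) a * z a ^ (i + 1)) = rest i + u * z m ^ (i + 1)" for i
        using Suc.prems(1) unfolding rest_def
        by (subst sum.remove[of _ m]) (auto intro!: sum.cong)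
      then show ?thesis
        unfolding Q_def hom_insertion[OF comm_ring_hom_poly] by simp
    qed
    have "poly Q (real j) = 0" for j
      unfolding Q
    proof (rule Suc.IH)
      show "m \<le> n" using Suc.prems by simp
      show "(y(m := real j)) a \<in> \<nat>" if "m \<le> a" "a < n" for a
        using Suc.prems(2)[of a] that by auto
    qed
    then have "range real \<subseteq> {u. poly Q u = 0}" by auto
    moreover have "infinite (range real)" by (rule range_inj_infinite) (simp add: inj_on_def)
    ultimately have "infinite {u. poly Q u = 0}" using finite_subset by blast
    then have "Q = 0" using poly_roots_finite by blast
    then show ?case using Q[of "y m"] by simp
  qed
  from this[of n y] show ?thesis by simp
qed

text \<open>Kronecker substitution: variable \<open>v\<close> becomes the power \<open>B ^ v\<close>
  of one indeterminate, with \<open>B\<close> chosen so that the finitely many monomials of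
  \<open>P\<close> get different exponents and no coefficients merge.\<close>

lemma real_eval_eq_0_imp_eq_0:
  assumes P: "\<And>c. real_eval c P = 0"
  shows "P = 0"
proof -
  define V where "V = (\<Union>m\<in>Poly_Mapping.keys P. Poly_Mapping.keys m)"
  have V: "finite V" "\<And>m. m \<in> Poly_Mapping.keys P \<Longrightarrow> Poly_Mapping.keys m \<subseteq> V"
    by (auto simp: V_def)
  define e where "e B m = (\<Sum>v\<in>V. B ^ v * Poly_Mapping.lookup m v)" for B and m :: "nat \<Rightarrow>\<^sub>0 nat"
  have "\<exists>B. inj_on (e B) (Poly_Mapping.keys P)"
  proof -
    \<comment> \<open>Two exponent vectors collide under \<open>B\<close> only if \<open>B\<close>
      is a root of their difference polynomial \<open>D\<close>, which is nonzero. Finitely many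
      roots leave some natural \<open>B\<close> available.\<close>
    define D where "D m m' = (\<Sum>v\<in>V. monom (real (Poly_Mapping.lookup m v) - real (Poly_Mapping.lookup m' v)) v)"
      for m m' :: "nat \<Rightarrow>\<^sub>0 nat"
    have D: "D m m' \<noteq> 0" if "m \<in> Poly_Mapping.keys P" "m' \<in> Poly_Mapping.keys P" "m \<noteq> m'" for m m'
    proof
      assume 0: "D m m' = 0"
      have "Poly_Mapping.lookup m v = Poly_Mapping.lookup m' v" for v
      proof (cases "v \<in> V")
        case True
        have "coeff (D m m') v = real (Poly_Mapping.lookup m v) - real (Poly_Mapping.lookup m' v)"
          using True V(1) by (simp add: D_def coeff_sum)
        then show ?thesis using 0 by simp
      next
        case False
        then have "v \<notin> Poly_Mapping.keys m" "v \<notin> Poly_Mapping.keys m'" using V(2) that by auto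
        then show ?thesis by (simp add: in_keys_iff)
      qed
      with \<open>m \<noteq> m'\<close> show False using poly_mapping_eqI by blast
    qed
    define Z where "Z = (\<Union>m\<in>Poly_Mapping.keys P. \<Union>m'\<in>Poly_Mapping.keys P - {m}. {u. poly (D m m') u = 0})"
    have "finite Z" unfolding Z_def using D by (intro finite_UN_I poly_roots_finite) auto
    moreover have "infinite (range real)" by (rule range_inj_infinite) (simp add: inj_on_def)
    ultimately obtain B where B: "real B \<notin> Z" by (metis finite_subset image_subsetI)
    have "inj_on (e B) (Poly_Mapping.keys P)"
    proof (rule inj_onI, rule ccontr)
      fix m m' assume m: "m \<in> Poly_Mapping.keys P" "m' \<in> Poly_Mapping.keys P"
        and eq: "e B m = e B m'" and "m \<noteq> m'"
      have "poly (D m m') (real B) = real (e B m) - real (e B m')"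
        by (simp add: D_def e_def poly_sum poly_monom algebra_simps sum_subtractf)
      then have "real B \<in> Z" using m \<open>m \<noteq> m'\<close> eq by (auto simp: Z_def)
      with B show False ..
    qed
    then show ?thesis by blast
  qed
  then obtain B where B: "inj_on (e B) (Poly_Mapping.keys P)" by blast
  define Q where "Q = insertion (\<lambda>a. [:a:]) (\<lambda>v. monom (1::real) (B ^ v)) P"
  have "poly Q y = 0" for y
    unfolding Q_def hom_insertion[OF comm_ring_hom_poly] by (simp add: P)
  then have "Q = 0" by (simp add: poly_all_0_iff_0[symmetric])
  have "Q = (\<Sum>m\<in>Poly_Mapping.keys P. monom (Poly_Mapping.lookup P m) (e B m))"
    unfolding Q_def insertion_def monom_value_def[symmetric]
  proof (rule sum.cong[OF refl])
    fix m assume "m \<in> Poly_Mapping.keys P"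
    have *: "(\<Prod>v\<in>W. monom (1::real) (f v)) = monom 1 (\<Sum>v\<in>W. f v)" if "finite W" for W :: "nat set" and f
      using that by (induction rule: finite_induct) (simp_all add: mult_monom)
    have "monom_value (\<lambda>v. monom (1::real) (B ^ v)) m = monom 1 (e B m)"
      using V \<open>m \<in> _\<close> by (simp add: monom_value_superset[of V] monom_power * e_def)
    then show "[:Poly_Mapping.lookup P m:] * monom_value (\<lambda>v. monom 1 (B ^ v)) m =
        monom (Poly_Mapping.lookup P m) (e B m)"
      by (simp add: smult_monom)
  qed
  with \<open>Q = 0\<close> have 0: "(\<Sum>m\<in>Poly_Mapping.keys P. monom (Poly_Mapping.lookup P m) (e B m)) = 0" by simp
  have "Poly_Mapping.lookup P k = 0" for k
  proof (cases "k \<in> Poly_Mapping.keys P")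
    case True
    have "(\<Sum>m\<in>Poly_Mapping.keys P. coeff (monom (Poly_Mapping.lookup P m) (e B m)) (e B k)) =
        (\<Sum>m\<in>Poly_Mapping.keys P. if m = k then Poly_Mapping.lookup P k else 0)"
      using B True by (intro sum.cong) (auto simp: inj_on_eq_iff)
    then show ?thesis using arg_cong[OF 0, of "\<lambda>p. coeff p (e B k)"] True by (simp add: coeff_sum)
  qed (simp add: in_keys_iff)
  then show ?thesis by (intro poly_mapping_eqI) simp
qed

text \<open>Letting \<open>k a\<close> of the variables be equal to \<open>a + 1\<close> turns the vector of power sums into a linear
  function of \<open>k\<close>, which is invertible (Vandermonde); a polynomial vanishing at all natural
  \<open>k\<close> vanishes identically.\<close>

lemma power_sums_algebraically_independent:
  assumes "\<And>N. insertion const (\<lambda>i. power_sum (i + 1) N) P = 0"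
  shows "P = 0"
proof (rule real_eval_eq_0_imp_eq_0)
  fix c :: "nat \<Rightarrow> real"
  have vanish: "real_eval (\<lambda>i. \<Sum>v<N. \<tau> v ^ (i + 1)) P = 0" for N and \<tau> :: "nat \<Rightarrow> real"
  proof -
    interpret ev: comm_ring_hom "real_eval \<tau>"
      by (intro comm_ring_hom_insertion comm_ring_hom_id)
    have "real_eval \<tau> (insertion const (\<lambda>i. power_sum (i + 1) N) P) =
        real_eval (\<lambda>i. \<Sum>v<N. \<tau> v ^ (i + 1)) P"
      by (simp add: hom_insertion[OF ev.comm_ring_hom_axioms] insertion_const[OF comm_ring_hom_id]
          insertion_pvar[OF comm_ring_hom_id] power_sum_def hom_distribs del: power_Suc)
    then show ?thesis unfolding assms ev.hom_zero by (rule sym)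
  qed
  \<comment> \<open>\<open>n\<close> exceeds every variable index in \<open>P\<close>, so only the
    first \<open>n\<close> entries of \<open>c\<close> matter; the inserted 0 covers a
    \<open>P\<close> without variables.\<close>
  define n where "n = Suc (Max (insert 0 (\<Union>m\<in>Poly_Mapping.keys P. Poly_Mapping.keys m)))"
  have n: "v < n" if "m \<in> Poly_Mapping.keys P" "v \<in> Poly_Mapping.keys m" for m v
    unfolding n_def less_Suc_eq_le by (rule Max_ge) (use that in auto)
  \<comment> \<open>The nodes \<open>real a + 1\<close> are nonzero. Since the power sums start at
    exponent 1, each weight is later divided by its node.\<close>
  obtain \<alpha> where \<alpha>: "\<And>d. d < n \<Longrightarrow> c d = (\<Sum>a<n. \<alpha> a * (real a + 1) ^ d)"
    using vandermonde_system_solvable[of "{..<n}" "\<lambda>a. real a + 1" c] by (auto simp: inj_on_def)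
  have "real_eval c P = real_eval (\<lambda>i. \<Sum>a<n. (\<alpha> a / (real a + 1)) * (real a + 1) ^ (i + 1)) P"
  proof (rule insertion_cong)
    fix m v assume "m \<in> Poly_Mapping.keys P" "v \<in> Poly_Mapping.keys m"
    have "\<alpha> a / (real a + 1) * (real a + 1) ^ (v + 1) = \<alpha> a * (real a + 1) ^ v" for a
      by (simp add: field_simps)
    then show "c v = (\<Sum>a<n. \<alpha> a / (real a + 1) * (real a + 1) ^ (v + 1))"
      using \<alpha>[OF n[OF \<open>m \<in> _\<close> \<open>v \<in> _\<close>]] by (simp only:)
  qed
  also have "\<dots> = 0" by (rule real_eval_eq_0_on_real_multiplicities[OF vanish])
  finally show "real_eval c P = 0" .
qed

text \<open>By algebraic independence the expansion is unique, so exhibiting one resolves the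
  definite description.\<close>

lemma power_sum_expansion_eqI:
  assumes "\<And>N. insertion const (\<lambda>i. power_sum (i + 1) N) P = f N"
  shows "power_sum_expansion f = P"
  unfolding power_sum_expansion_def
proof (rule the_equality)
  show "\<forall>N. insertion const (\<lambda>i. power_sum (i + 1) N) P = f N" using assms by blast
  fix Q assume Q: "\<forall>N. insertion const (\<lambda>i. power_sum (i + 1) N) Q = f N"
  have "insertion const (\<lambda>i. power_sum (i + 1) N) (Q - P) = 0" for N
  proof -
    interpret ins: comm_ring_hom "insertion const (\<lambda>i. power_sum (i + 1) N)"
      by (intro comm_ring_hom_insertion comm_ring_hom_const)
    show ?thesis unfolding ins.hom_minus using Q assms by simp
  qed
  then have "Q - P = 0" by (rule power_sums_algebraically_independent)
  then show "Q = P" by simp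
qed

section \<open>Newton's identities and the expansion of complete functions in power sums\<close>

lemma monom_degree_superset:
  assumes "finite V" "Poly_Mapping.keys m \<subseteq> V"
  shows "monom_degree m = (\<Sum>v\<in>V. Poly_Mapping.lookup m v)"
  unfolding monom_degree_def
  by (rule sum.mono_neutral_left) (use assms in \<open>auto simp: in_keys_iff\<close>)

lemma monom_degree_add: "monom_degree (m + m') = monom_degree m + monom_degree m'"
proof -
  let ?V = "Poly_Mapping.keys m \<union> Poly_Mapping.keys m'"
  have "Poly_Mapping.keys (m + m') \<subseteq> ?V" by (rule keys_add)
  then show ?thesis by (simp add: monom_degree_superset[of ?V] lookup_add sum.distrib)
qed

lemma monom_degree_single [simp]: "monom_degree (Poly_Mapping.single v e) = e"
  by (cases "e = 0") (simp_all add: monom_degree_def)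

definition monoms :: "nat \<Rightarrow> nat \<Rightarrow> (nat \<Rightarrow>\<^sub>0 nat) set" where
  "monoms N j = {m. Poly_Mapping.keys m \<subseteq> {..<N} \<and> monom_degree m = j}"

lemma lookup_le_monom_degree: "Poly_Mapping.lookup m v \<le> monom_degree m"
proof (cases "v \<in> Poly_Mapping.keys m")
  case True
  then show ?thesis unfolding monom_degree_def by (intro member_le_sum) auto
qed (simp add: in_keys_iff)

lemma finite_monoms: "finite (monoms N j)"
proof (rule finite_subset)
  show "monoms N j \<subseteq> Poly_Mapping.lookup -`
      {f. \<forall>v. (v \<in> {..<N} \<longrightarrow> f v \<in> {..j}) \<and> (v \<notin> {..<N} \<longrightarrow> f v = 0)}"
    using lookup_le_monom_degree by (auto simp: monoms_def in_keys_iff subset_eq)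
  show "finite (Poly_Mapping.lookup -`
      {f. \<forall>v. (v \<in> {..<N} \<longrightarrow> f v \<in> {..j}) \<and> (v \<notin> {..<N} \<longrightarrow> f v = 0)})"
    by (intro finite_vimageI finite_set_of_finite_funs) (auto simp: inj_on_def lookup_inject)
qed

lemma complete_sym_nat: "complete_sym (int j) N = (\<Sum>m\<in>monoms N j. Poly_Mapping.single m 1)"
  by (simp add: complete_sym_def monoms_def)

lemma complete_sym_0: "complete_sym 0 N = 1"
proof -
  have "monoms N 0 = {0}"
    by (auto simp: monoms_def monom_degree_def in_keys_iff intro!: poly_mapping_eqI)
  then show ?thesis using complete_sym_nat[of 0 N] by simp
qed

lemma complete_sym_neg: "j < 0 \<Longrightarrow> complete_sym j N = 0"
  by (simp add: complete_sym_def)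

text \<open>Newton's identity by counting: a monomial \<open>m\<close> of degree
  \<open>Suc j\<close> arises from a variable \<open>v\<close> and an \<open>i\<close> exactly when
  \<open>i + 1\<close> is at most the exponent of \<open>v\<close> in \<open>m\<close>. Its
  multiplicity is therefore the sum of its exponents.\<close>

lemma complete_sym_newton:
  "(\<Sum>i\<le>j. power_sum (i + 1) N * complete_sym (int (j - i)) N) =
    of_nat (Suc j) * complete_sym (int (Suc j)) N"
proof -
  have shift: "(\<Sum>m\<in>monoms N (j - i). Poly_Mapping.single (Poly_Mapping.single v (i + 1) + m) 1) =
      (\<Sum>m\<in>monoms N (Suc j). if i + 1 \<le> Poly_Mapping.lookup m v then Poly_Mapping.single m 1 else 0 :: mpoly)"
    if "i \<le> j" "v < N" for i v
  proof -
    let ?s = "Poly_Mapping.single v (i + 1)"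
    have inv: "?s + (m - ?s) = m" if "i + 1 \<le> Poly_Mapping.lookup m v" for m
      using that by (intro poly_mapping_eqI) (auto simp: lookup_add lookup_minus lookup_single when_def)
    have "(\<Sum>m\<in>monoms N (j - i). Poly_Mapping.single (?s + m) 1) =
        (\<Sum>m | m \<in> monoms N (Suc j) \<and> i + 1 \<le> Poly_Mapping.lookup m v. Poly_Mapping.single m 1 :: mpoly)"
    proof (rule sum.reindex_bij_witness[where i = "\<lambda>m. m - ?s" and j = "\<lambda>m. ?s + m"])
      fix m assume m: "m \<in> monoms N (j - i)"
      show "?s + m - ?s = m" by simp
      have "Poly_Mapping.keys (?s + m) \<subseteq> {..<N}"
        using keys_add[of ?s m] m \<open>v < N\<close> by (auto simp: monoms_def)
      then show "?s + m \<in> {m \<in> monoms N (Suc j). i + 1 \<le> Poly_Mapping.lookup m v}"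
        using m \<open>i \<le> j\<close> by (simp add: monoms_def monom_degree_add lookup_add)
    next
      fix m assume m: "m \<in> {m \<in> monoms N (Suc j). i + 1 \<le> Poly_Mapping.lookup m v}"
      then show eq: "?s + (m - ?s) = m" using inv by simp
      have "Poly_Mapping.keys (m - ?s) \<subseteq> Poly_Mapping.keys m"
        by (auto simp: in_keys_iff lookup_minus)
      moreover have "monom_degree m = i + 1 + monom_degree (m - ?s)"
        by (subst eq[symmetric]) (simp only: monom_degree_add monom_degree_single)
      ultimately show "m - ?s \<in> monoms N (j - i)" using m by (auto simp: monoms_def)
    qed auto
    then show ?thesis by (simp add: sum.inter_filter[OF finite_monoms])
  qed
  have count: "(\<Sum>i\<le>j. if i + 1 \<le> e then c else 0) = of_nat e * c" if "e \<le> Suc j" for e and c :: mpoly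
  proof -
    have "{..j} \<inter> {i. i + 1 \<le> e} = {..<e}" using that by auto
    then show ?thesis by (simp add: sum.If_cases)
  qed
  have "(\<Sum>i\<le>j. power_sum (i + 1) N * complete_sym (int (j - i)) N) =
      (\<Sum>i\<le>j. \<Sum>v<N. \<Sum>m\<in>monoms N (j - i). Poly_Mapping.single (Poly_Mapping.single v (i + 1) + m) 1)"
    by (simp only: power_sum_def complete_sym_nat sum_product pvar_power mult_single mult_1)
  also have "\<dots> = (\<Sum>i\<le>j. \<Sum>v<N. \<Sum>m\<in>monoms N (Suc j).
      if i + 1 \<le> Poly_Mapping.lookup m v then Poly_Mapping.single m 1 else 0)"
    by (intro sum.cong refl shift) auto
  also have "\<dots> = (\<Sum>m\<in>monoms N (Suc j). \<Sum>v<N. \<Sum>i\<le>j.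
      if i + 1 \<le> Poly_Mapping.lookup m v then Poly_Mapping.single m 1 else 0)"
    by (subst (2) sum.swap, subst sum.swap, subst (2) sum.swap) (rule refl)
  also have "\<dots> = (\<Sum>m\<in>monoms N (Suc j). of_nat (Suc j) * Poly_Mapping.single m 1)"
  proof (rule sum.cong[OF refl])
    fix m assume m: "m \<in> monoms N (Suc j)"
    have "(\<Sum>v<N. \<Sum>i\<le>j. if i + 1 \<le> Poly_Mapping.lookup m v then Poly_Mapping.single m 1 else 0) =
        (\<Sum>v<N. of_nat (Poly_Mapping.lookup m v) * (Poly_Mapping.single m 1 :: mpoly))"
      using m lookup_le_monom_degree[of m] by (intro sum.cong refl count) (auto simp: monoms_def)
    also have "\<dots> = of_nat (\<Sum>v<N. Poly_Mapping.lookup m v) * Poly_Mapping.single m 1"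
      by (simp only: sum_distrib_right of_nat_sum)
    also have "(\<Sum>v<N. Poly_Mapping.lookup m v) = Suc j"
      using m monom_degree_superset[of "{..<N}" m] by (simp add: monoms_def)
    finally show "(\<Sum>v<N. \<Sum>i\<le>j. if i + 1 \<le> Poly_Mapping.lookup m v then Poly_Mapping.single m 1 else 0) =
        of_nat (Suc j) * (Poly_Mapping.single m 1 :: mpoly)" .
  qed
  finally show ?thesis by (simp only: complete_sym_nat sum_distrib_left)
qed

text \<open>Newton's identities solved for the complete functions; variable \<open>i\<close> stands
  for the power sum of degree \<open>i + 1\<close>, as in
  \<open>power_sum_expansion\<close>.\<close>

fun newton_poly :: "nat \<Rightarrow> mpoly" where
  "newton_poly 0 = 1"
| "newton_poly (Suc j) = const (1 / real (Suc j)) * (\<Sum>i\<le>j. pvar i * newton_poly (j - i))"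

declare newton_poly.simps(2) [simp del]

lemma insertion_newton_poly_0:
  assumes "comm_ring_hom h"
  shows "insertion h s (newton_poly 0) = 1"
proof -
  interpret comm_ring_hom "insertion h s" by (rule comm_ring_hom_insertion[OF assms])
  show ?thesis by simp
qed

text \<open>The coefficient map is general because both \<open>const\<close> and
  \<open>rconst\<close> are needed. Being a ring homomorphism, \<open>h\<close> sends
  \<open>1 / real (Suc j)\<close> to an inverse of \<open>of_nat (Suc j)\<close>.\<close>

lemma insertion_newton_poly_Suc:
  assumes "comm_ring_hom h"
  shows "of_nat (Suc j) * insertion h s (newton_poly (Suc j)) =
    (\<Sum>i\<le>j. s i * insertion h s (newton_poly (j - i)))"
proof -
  interpret h: comm_ring_hom h by fact
  interpret comm_ring_hom "insertion h s" by (rule comm_ring_hom_insertion[OF assms])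
  have "of_nat (Suc j) * h (1 / real (Suc j)) = h (of_nat (Suc j) * (1 / real (Suc j)))"
    by (simp only: h.hom_mult h.hom_of_nat)
  also have "\<dots> = 1" by simp
  finally have "of_nat (Suc j) * h (1 / real (Suc j)) = 1" .
  then show ?thesis
    unfolding newton_poly.simps
    by (simp only: hom_mult hom_sum insertion_const[OF assms] insertion_pvar[OF assms]
        mult.assoc[symmetric] mult_1)
qed

lemma insertion_newton_poly_power_sums:
  "insertion const (\<lambda>i. power_sum (i + 1) N) (newton_poly j) = complete_sym (int j) N"
proof (induction j rule: less_induct)
  case (less j)
  show ?case
  proof (cases j)
    case 0
    then show ?thesis
      unfolding 0 insertion_newton_poly_0[OF comm_ring_hom_const] by (simp add: complete_sym_0)
  next
    case (Suc l)
    have "of_nat (Suc l) * insertion const (\<lambda>i. power_sum (i + 1) N) (newton_poly (Suc l)) =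
        (\<Sum>i\<le>l. power_sum (i + 1) N * complete_sym (int (l - i)) N)"
      unfolding insertion_newton_poly_Suc[OF comm_ring_hom_const]
      by (intro sum.cong refl arg_cong2[of _ _ _ _ "(*)"] less.IH) (auto simp: Suc)
    also have "\<dots> = of_nat (Suc l) * complete_sym (int (Suc l)) N"
      by (rule complete_sym_newton)
    finally show ?thesis
      unfolding Suc by (simp only: mult_cancel_left of_nat_eq_0_iff) simp
  qed
qed

text \<open>The complete function when the power sum of degree \<open>i + 1\<close> takes the value
  \<open>s i\<close>. Any sequence \<open>s\<close> is allowed, so alphabets can be altered through
  their power sums alone.\<close>

definition complete_value :: "(nat \<Rightarrow> ratfun) \<Rightarrow> int \<Rightarrow> ratfun" where
  "complete_value s j = (if j < 0 then 0 else insertion rconst s (newton_poly (nat j)))"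

lemma pleth_complete_sym:
  "pleth (complete_sym j) E = complete_value (\<lambda>i. power_sum_pleth (i + 1) E) j"
proof (cases "j < 0")
  case True
  have "power_sum_expansion (complete_sym j) = 0"
    by (rule power_sum_expansion_eqI) (simp add: True complete_sym_neg insertion_def)
  moreover have "insertion rconst \<sigma> 0 = 0" for \<sigma> by (simp add: insertion_def)
  ultimately show ?thesis using True by (simp add: pleth_def complete_value_def)
next
  case False
  have "power_sum_expansion (complete_sym j) = newton_poly (nat j)"
    by (rule power_sum_expansion_eqI) (use False in \<open>simp only: insertion_newton_poly_power_sums; simp\<close>)
  then show ?thesis using False by (simp add: pleth_def complete_value_def)
qed

section \<open>Generating functions and changes of alphabet\<close>

lemma fps_deriv_unique:
  fixes F G :: "ratfun fps"
  assumes "fps_deriv F = A * F" "fps_deriv G = A * G" "fps_nth F 0 = fps_nth G 0"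
  shows "F = G"
proof (rule fps_ext)
  fix j
  show "fps_nth F j = fps_nth G j"
  proof (induction j rule: less_induct)
    case (less j)
    show ?case
    proof (cases j)
      case (Suc l)
      have "of_nat (Suc l) * fps_nth F (Suc l) = (\<Sum>i = 0..l. fps_nth A i * fps_nth F (l - i))"
        using arg_cong[OF assms(1), of "\<lambda>F. fps_nth F l"] by (simp add: fps_mult_nth)
      also have "\<dots> = (\<Sum>i = 0..l. fps_nth A i * fps_nth G (l - i))"
        by (intro sum.cong refl arg_cong2[of _ _ _ _ "(*)"] less.IH) (auto simp: Suc)
      also have "\<dots> = of_nat (Suc l) * fps_nth G (Suc l)"
        using arg_cong[OF assms(2), of "\<lambda>F. fps_nth F l"] by (simp add: fps_mult_nth)
      finally show ?thesis unfolding Suc by (simp only: mult_cancel_left of_nat_ratfun_eq_0_iff) simp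
    qed (simp add: assms)
  qed
qed

definition complete_fps :: "(nat \<Rightarrow> ratfun) \<Rightarrow> ratfun fps" where
  "complete_fps s = Abs_fps (\<lambda>j. complete_value s (int j))"

lemma complete_fps_nth_0: "fps_nth (complete_fps s) 0 = 1"
  by (simp add: complete_fps_def complete_value_def insertion_newton_poly_0[OF comm_ring_hom_rconst]
      del: newton_poly.simps(1))

text \<open>Newton's identities as a linear differential equation, which stands in for the
  exponential formula.\<close>

lemma fps_deriv_complete_fps: "fps_deriv (complete_fps s) = Abs_fps s * complete_fps s"
proof (rule fps_ext)
  fix j
  show "fps_nth (fps_deriv (complete_fps s)) j = fps_nth (Abs_fps s * complete_fps s) j"
    using insertion_newton_poly_Suc[OF comm_ring_hom_rconst, of j s]
    by (simp add: complete_fps_def complete_value_def fps_mult_nth atMost_atLeast0 nat_diff_distrib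
        del: of_nat_Suc)
qed

lemma geometric_fps:
  "Abs_fps (\<lambda>i. c ^ (i + 1)) * (1 - fps_const c * fps_X) = fps_const (c :: 'a::comm_ring_1)"
proof -
  let ?A = "Abs_fps (\<lambda>i. c ^ (i + 1))"
  have "?A * (1 - fps_const c * fps_X) =
      ?A - ?A * fps_const c * fps_X"
    by (simp add: right_diff_distrib mult.assoc)
  also have "\<dots> = fps_const c"
  proof (rule fps_ext)
    show "fps_nth (?A - ?A * fps_const c * fps_X) j = fps_nth (fps_const c) j" for j
      by (cases j) (simp_all add: mult.commute)
  qed
  finally show ?thesis .
qed

text \<open>Adding \<open>t x\<close> to the alphabet and removing \<open>x\<close> multiplies the
  generating function by the quotient of \<open>1 - x z\<close> and \<open>1 - t x z\<close>. The
  candidate \<open>G\<close> solves the differential equation of \<open>s'\<close> with the same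
  constant term.\<close>

lemma complete_fps_add_letter:
  assumes s': "\<And>i. s' i = s i + ((t * x) ^ (i + 1) - x ^ (i + 1))"
  shows "complete_fps s' * (1 - fps_const (t * x) * fps_X) =
    complete_fps s * (1 - fps_const x * fps_X)"
proof -
  define u where "u = 1 - fps_const (t * x) * fps_X"
  define v where "v = 1 - fps_const x * fps_X"
  define F where "F = complete_fps s"
  define G where "G = F * v * inverse u"
  define Eu where "Eu = Abs_fps (\<lambda>i. (t * x) ^ (i + 1))"
  define Ev where "Ev = Abs_fps (\<lambda>i. x ^ (i + 1))"
  have u0: "fps_nth u 0 = 1" and v0: "fps_nth v 0 = 1" by (simp_all add: u_def v_def)
  then have uv: "u \<noteq> 0" "v \<noteq> 0" by auto
  have Eu: "Eu * u = fps_const (t * x)" unfolding Eu_def u_def by (rule geometric_fps)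
  have Ev: "Ev * v = fps_const x" unfolding Ev_def v_def by (rule geometric_fps)
  have Gu: "G * u = F * v"
    using u0 by (simp add: G_def mult.assoc inverse_mult_eq_1)
  have s'_fps: "Abs_fps s' = Abs_fps s + (Eu - Ev)"
    by (rule fps_ext) (simp add: Eu_def Ev_def s')
  have du: "fps_deriv u = - fps_const (t * x)" and dv: "fps_deriv v = - fps_const x"
    by (simp_all add: u_def v_def)
  have dF: "fps_deriv F = Abs_fps s * F" unfolding F_def by (rule fps_deriv_complete_fps)
  have "fps_deriv G * u + G * fps_deriv u = fps_deriv F * v + F * fps_deriv v"
    using arg_cong[OF Gu, of fps_deriv] by (simp add: add.commute)
  then have dG: "fps_deriv G * u = Abs_fps s * (F * v) - F * fps_const x + G * fps_const (t * x)"
    unfolding du dv dF by (simp add: algebra_simps del: fps_const_neg)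
  \<comment> \<open>The extra factor \<open>v\<close> lets the two constants be rewritten as
    \<open>Ev * v\<close> and \<open>Eu * u\<close>, after which \<open>u\<close> and
    \<open>v\<close> cancel.\<close>
  have "(fps_deriv G * u) * v = (Abs_fps s * (F * v)) * v - (F * v) * fps_const x + G * v * fps_const (t * x)"
    unfolding dG by (simp add: algebra_simps)
  also have "\<dots> = (Abs_fps s * (G * u)) * v - (G * u) * (Ev * v) + G * v * (Eu * u)"
    unfolding Gu Eu Ev ..
  also have "\<dots> = (Abs_fps s' * G) * u * v"
    unfolding s'_fps by (simp add: algebra_simps)
  finally have "fps_deriv G = Abs_fps s' * G" using uv by simp
  moreover have "fps_nth G 0 = 1"
    using u0 v0 by (simp add: G_def F_def complete_fps_nth_0 fps_inverse_nth_0)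
  ultimately have "complete_fps s' = G"
    by (intro fps_deriv_unique[OF fps_deriv_complete_fps]) (auto simp: complete_fps_nth_0)
  then show ?thesis using Gu by (simp add: F_def u_def v_def)
qed

lemma complete_fps_add_letters:
  fixes x :: "nat \<Rightarrow> ratfun"
  assumes "finite J"
  shows "complete_fps (\<lambda>i. s i + (\<Sum>j\<in>J. (t * x j) ^ (i + 1) - x j ^ (i + 1))) *
      (\<Prod>j\<in>J. 1 - fps_const (t * x j) * fps_X) =
    complete_fps s * (\<Prod>j\<in>J. 1 - fps_const (x j) * fps_X)"
  using assms
proof (induction J rule: finite_induct)
  case (insert l J)
  let ?s = "\<lambda>J i. s i + (\<Sum>j\<in>J. (t * x j) ^ (i + 1) - x j ^ (i + 1))"
  let ?u = "\<lambda>j. 1 - fps_const (t * x j) * fps_X" and ?v = "\<lambda>j. 1 - fps_const (x j) * fps_X"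
  have "?s (insert l J) i = ?s J i + ((t * x l) ^ (i + 1) - x l ^ (i + 1))" for i
    using insert.hyps by (simp add: algebra_simps)
  from complete_fps_add_letter[of "?s (insert l J)" "?s J", OF this]
  have "complete_fps (?s (insert l J)) * ?u l = complete_fps (?s J) * ?v l" .
  then have "complete_fps (?s (insert l J)) * ?u l * prod ?u J = complete_fps (?s J) * prod ?u J * ?v l"
    by (simp only: mult_ac)
  also have "\<dots> = complete_fps s * prod ?v J * ?v l" by (simp only: insert.IH)
  finally have "complete_fps (?s (insert l J)) * (?u l * prod ?u J) = complete_fps s * (?v l * prod ?v J)"
    by (simp only: mult_ac)
  then show ?case by (simp only: prod.insert[OF insert.hyps])
qed simp

section \<open>Macdonald operators\<close>

lemma monomial_eq_iff:
  "(Poly_Mapping.single m 1 :: mpoly) = Poly_Mapping.single m' 1 \<longleftrightarrow> m = m'"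
proof
  assume "(Poly_Mapping.single m 1 :: mpoly) = Poly_Mapping.single m' 1"
  from arg_cong[OF this, of "\<lambda>P. Poly_Mapping.lookup P m"] show "m = m'"
    by (simp add: lookup_single when_def split: if_splits)
qed simp

lemma rvar_eq_iff [simp]: "rvar v = rvar w \<longleftrightarrow> v = w"
proof
  assume "rvar v = rvar w"
  then have eq: "Poly_Mapping.single v (1::nat) = Poly_Mapping.single w 1"
    by (simp only: rvar_eq to_fract_eq_iff pvar_def monomial_eq_iff)
  from arg_cong[OF eq, of "\<lambda>m. Poly_Mapping.lookup m v"] show "v = w"
    by (simp add: lookup_single when_def split: if_splits)
qed simp

lemma rvar_nonzero [simp]: "rvar v \<noteq> 0"
proof
  assume "rvar v = 0"
  then have "pvar v = 0" by (simp only: rvar_eq to_fract_eq_0_iff)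
  from arg_cong[OF this, of "\<lambda>P. Poly_Mapping.lookup P (Poly_Mapping.single v 1)"] show False
    by (simp add: pvar_def)
qed

text \<open>Total degrees 2 and 1 differ. This gives \<open>t x_i \<noteq> x_j\<close>, the
  separation of nodes that the determinantal identity requires.\<close>

lemma rvar_mult_neq_rvar: "rvar u * rvar v \<noteq> rvar w"
proof
  assume "rvar u * rvar v = rvar w"
  then have "pvar u * pvar v = pvar w"
    by (simp only: rvar_eq to_fract_eq_iff flip: to_fract_mult)
  then have "Poly_Mapping.single u 1 + Poly_Mapping.single v 1 = Poly_Mapping.single w (1::nat)"
    by (simp only: pvar_def mult_single mult_1 monomial_eq_iff)
  from arg_cong[OF this, of monom_degree] show False
    by (simp only: monom_degree_add monom_degree_single)
qed

text \<open>Keeps the denominators \<open>qvar ^ i - 1\<close> in the power sums of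
  \<open>Xtq n\<close> nonzero.\<close>

lemma rvar_power_neq_1:
  assumes "0 < k"
  shows "rvar v ^ k \<noteq> 1"
proof
  assume "rvar v ^ k = 1"
  then have "pvar v ^ k = 1"
    by (simp only: rvar_eq to_fract.hom_power[symmetric] to_fract_1[symmetric] to_fract_eq_iff)
  then have "(Poly_Mapping.single (Poly_Mapping.single v k) 1 :: mpoly) = Poly_Mapping.single 0 1"
    by (simp add: pvar_power)
  then have "Poly_Mapping.single v k = 0" by (simp only: monomial_eq_iff)
  from arg_cong[OF this, of "\<lambda>m. Poly_Mapping.lookup m v"] show False
    using assms by simp
qed

lemma resultant_image:
  assumes "inj_on f I" "inj_on g J"
  shows "resultant (f ` I) (g ` J) = (\<Prod>i\<in>I. \<Prod>j\<in>J. f i - g j)"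
  unfolding resultant_def using assms by (simp add: prod.reindex)

section \<open>Action of the q-shifts on power sums and Schur determinants\<close>

lemma power_sum_pleth_Xtq:
  assumes "0 < i"
  shows "power_sum_pleth i (Xtq n) = (\<Sum>j = 1..n. xvar j ^ i) * (tvar ^ i - 1) / (qvar ^ i - 1)"
proof -
  note inj = injective_subst_power[OF assms]
  interpret comm_ring_hom "rsubst (\<lambda>v. rvar v ^ i)" by (rule comm_ring_hom_rsubst[OF inj])
  show ?thesis
    by (simp add: power_sum_pleth_def Xtq_def Xsum_def rsubst_divide[OF inj] rsubst_rvar[OF inj] hom_distribs)
qed

lemma power_sum_pleth_Xtq_add_Xt:
  assumes "0 < i"
  shows "power_sum_pleth i (Xtq n + Xt n) =
    power_sum_pleth i (Xtq n) + (\<Sum>j = 1..n. (tvar * xvar j) ^ i - xvar j ^ i)"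
proof -
  note inj = injective_subst_power[OF assms]
  interpret comm_ring_hom "rsubst (\<lambda>v. rvar v ^ i)" by (rule comm_ring_hom_rsubst[OF inj])
  have "rsubst (\<lambda>v. rvar v ^ i) (Xt n) = (\<Sum>j = 1..n. xvar j ^ i) * (tvar ^ i - 1)"
    by (simp add: Xt_def Xsum_def rsubst_rvar[OF inj] hom_distribs)
  also have "\<dots> = (\<Sum>j = 1..n. (tvar * xvar j) ^ i - xvar j ^ i)"
    unfolding sum_distrib_right by (intro sum.cong refl) (simp add: power_mult_distrib algebra_simps)
  finally show ?thesis by (simp add: power_sum_pleth_def hom_add)
qed

lemma injective_subst_Theta: "injective_subst (rvar(l + 1 := qvar * xvar l))"
  by (rule injective_subst_scale) simp

lemma comm_ring_hom_Theta: "comm_ring_hom (Theta l)"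
  unfolding Theta_def by (rule comm_ring_hom_rsubst[OF injective_subst_Theta])

interpretation Theta: comm_ring_hom "Theta l" for l by (rule comm_ring_hom_Theta)

lemma Theta_divide: "Theta l (E / F) = Theta l E / Theta l F"
  unfolding Theta_def by (rule rsubst_divide[OF injective_subst_Theta])

lemma Theta_rvar: "Theta l (rvar v) = (if v = l + 1 then qvar * rvar v else rvar v)"
  unfolding Theta_def rsubst_rvar[OF injective_subst_Theta] by simp

lemma Theta_rconst: "Theta l (rconst a) = rconst a"
  unfolding Theta_def by (rule rsubst_rconst[OF injective_subst_Theta])

text \<open>The power sums of \<open>X\<^sup>t\<^sup>q + (t - 1) X\<^sub>J\<close>, shifted by one in \<open>i\<close>.\<close>

definition shifted_power_sums :: "nat \<Rightarrow> nat set \<Rightarrow> nat \<Rightarrow> ratfun" where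
  "shifted_power_sums n J i = power_sum_pleth (i + 1) (Xtq n) +
    (\<Sum>j\<in>J. (tvar * xvar j) ^ (i + 1) - xvar j ^ (i + 1))"

text \<open>Scaling \<open>x_l\<close> by \<open>q\<close> adds a multiple of
  \<open>q ^ (i + 1) - 1\<close> to the power sum of \<open>X\<close>. This factor cancels the
  denominator in \<open>Xtq n\<close> and leaves the term of \<open>l\<close> in the shift, while
  \<open>l \<notin> J\<close> keeps the earlier terms fixed.\<close>

lemma Theta_shifted_power_sums:
  assumes l: "l \<in> {1..n}" "l \<notin> J" and "finite J"
  shows "Theta l (shifted_power_sums n J i) = shifted_power_sums n (insert l J) i"
proof -
  let ?k = "i + 1"
  have k: "0 < ?k" by simp
  have q: "qvar ^ ?k - 1 \<noteq> 0" using rvar_power_neq_1[OF k, of 0] by simp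
  have t: "Theta l tvar = tvar" using l by (simp add: Theta_rvar)
  have "Theta l (\<Sum>j = 1..n. xvar j ^ ?k) = (\<Sum>j = 1..n. Theta l (xvar j) ^ ?k)"
    by (simp only: Theta.hom_sum Theta.hom_power)
  also have "\<dots> = (qvar * xvar l) ^ ?k + (\<Sum>j\<in>{1..n} - {l}. xvar j ^ ?k)"
    using l by (subst sum.remove[of _ l]) (auto simp: Theta_rvar intro!: sum.cong)
  also have "\<dots> = (\<Sum>j = 1..n. xvar j ^ ?k) + (qvar ^ ?k - 1) * xvar l ^ ?k"
    using l by (subst sum.remove[of "{1..n}" l]) (auto simp: power_mult_distrib algebra_simps)
  finally have "Theta l (power_sum_pleth ?k (Xtq n)) =
      ((\<Sum>j = 1..n. xvar j ^ ?k) + (qvar ^ ?k - 1) * xvar l ^ ?k) * (tvar ^ ?k - 1) / (qvar ^ ?k - 1)"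
    unfolding power_sum_pleth_Xtq[OF k] Theta_divide
    by (simp only: Theta.hom_mult Theta.hom_minus Theta.hom_power Theta.hom_one t) (simp add: Theta_rvar)
  also have "\<dots> = power_sum_pleth ?k (Xtq n) + ((tvar * xvar l) ^ ?k - xvar l ^ ?k)"
  proof -
    have "(a + d * y) * (b - 1) / d = a * (b - 1) / d + (b * y - y)" if "d \<noteq> 0" for a b d y :: ratfun
      using that by (simp add: field_simps)
    from this[OF q] show ?thesis unfolding power_sum_pleth_Xtq[OF k] power_mult_distrib .
  qed
  finally have 1: "Theta l (power_sum_pleth ?k (Xtq n)) =
      power_sum_pleth ?k (Xtq n) + ((tvar * xvar l) ^ ?k - xvar l ^ ?k)" .
  have "Theta l (xvar j) = xvar j" if "j \<in> J" for j
    using that l by (auto simp: Theta_rvar)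
  then have 2: "Theta l (\<Sum>j\<in>J. (tvar * xvar j) ^ ?k - xvar j ^ ?k) =
      (\<Sum>j\<in>J. (tvar * xvar j) ^ ?k - xvar j ^ ?k)"
    unfolding Theta.hom_sum Theta.hom_minus Theta.hom_power Theta.hom_mult t
    by (intro sum.cong) auto
  show ?thesis
    unfolding shifted_power_sums_def Theta.hom_add 1 2 using assms(2,3) by (simp add: algebra_simps)
qed

text \<open>The Schur function of \<open>Xtq n\<close> enlarged by \<open>(t - 1) X_J\<close>: a
  family on which the q-shifts act by adding an index to \<open>J\<close>, starting from the empty
  set.\<close>

definition shifted_schur :: "nat \<Rightarrow> (nat \<Rightarrow> nat) \<Rightarrow> nat set \<Rightarrow> ratfun" where
  "shifted_schur n lam J = det (mat n n (\<lambda>(r, c).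
     complete_value (shifted_power_sums n J) (jt_index lam (r + 1) (c + 1))))"

lemma Theta_complete_value: "Theta l (complete_value s j) = complete_value (\<lambda>i. Theta l (s i)) j"
  by (simp add: complete_value_def hom_insertion[OF comm_ring_hom_Theta] Theta_rconst)

lemma Theta_shifted_schur:
  assumes "l \<in> {1..n}" "l \<notin> J" "finite J"
  shows "Theta l (shifted_schur n lam J) = shifted_schur n lam (insert l J)"
proof -
  have "map_mat (Theta l) (mat n n (\<lambda>(r, c). complete_value (shifted_power_sums n J) (jt_index lam (r + 1) (c + 1)))) =
      mat n n (\<lambda>(r, c). complete_value (shifted_power_sums n (insert l J)) (jt_index lam (r + 1) (c + 1)))"
    by (rule eq_matI) (auto simp: Theta_complete_value Theta_shifted_power_sums[OF assms])
  then show ?thesis unfolding shifted_schur_def by (metis Theta.hom_det)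
qed

lemma fold_Theta_shifted_schur:
  assumes "distinct ls" "set ls \<subseteq> {1..n}" "set ls \<inter> J = {}" "finite J"
  shows "fold Theta ls (shifted_schur n lam J) = shifted_schur n lam (J \<union> set ls)"
  using assms
proof (induction ls arbitrary: J)
  case (Cons l ls)
  then have "Theta l (shifted_schur n lam J) = shifted_schur n lam (insert l J)"
    by (intro Theta_shifted_schur) auto
  moreover have "fold Theta ls (shifted_schur n lam (insert l J)) = shifted_schur n lam (insert l J \<union> set ls)"
    using Cons.prems by (intro Cons.IH) auto
  ultimately show ?case by simp
qed simp

section \<open>Coefficients of the generating functions as moments of
  \<open>mixed_poly\<close>\<close>

lemma degree_mixed_poly:
  fixes x :: "nat \<Rightarrow> 'a::idom"
  assumes "J \<subseteq> {1..n}"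
  shows "degree (mixed_poly n x t J) = n"
proof -
  have fin: "finite J" using assms finite_subset by blast
  have "degree (mixed_poly n x t J) =
      degree (\<Prod>i\<in>J. [:- x i, 1:]) + degree (\<Prod>j\<in>{1..n} - J. [:- (t * x j), 1:])"
    unfolding mixed_poly_def using fin by (intro degree_mult_eq) auto
  also have "\<dots> = card J + card ({1..n} - J)"
    using fin by (simp add: degree_prod_eq_sum_degree)
  also have "\<dots> = n" using assms fin card_mono[OF _ assms] by (simp add: card_Diff_subset)
  finally show ?thesis .
qed

text \<open>A monic linear factor with root \<open>a\<close> reverses to \<open>1 - a z\<close>,
  also for \<open>a = 0\<close>, where the reversal is the constant 1.\<close>

lemma fps_of_reflect_mixed_poly:
  fixes x :: "nat \<Rightarrow> 'a::idom"
  shows "fps_of_poly (reflect_poly (mixed_poly n x t J)) =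
    (\<Prod>j\<in>J. 1 - fps_const (x j) * fps_X) * (\<Prod>j\<in>{1..n} - J. 1 - fps_const (t * x j) * fps_X)"
proof -
  have linear: "fps_of_poly (reflect_poly [:- a, 1:]) = 1 - fps_const a * fps_X" for a :: 'a
    by (cases "a = 0") (simp_all add: reflect_poly_def fps_of_poly_pCons)
  show ?thesis
    by (simp only: mixed_poly_def reflect_poly_mult reflect_poly_prod fps_of_poly_mult fps_of_poly_prod linear)
qed

lemma fps_prod_linear_nth_0:
  "fps_nth (\<Prod>j\<in>J. 1 - fps_const (c j :: 'a::comm_ring_1) * fps_X) 0 = 1"
  by (induction J rule: infinite_finite_induct) simp_all

text \<open>Once the full product of the \<open>1 - t x_j z\<close> is absorbed as a denominator
  into \<open>G\<close>, what remains for \<open>J\<close> is the reversed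
  \<open>mixed_poly\<close>. Hence \<open>g\<close> is the same for all \<open>J\<close>, which
  turns each row into a fixed moment functional.\<close>

lemma complete_value_shifted:
  obtains g :: "int \<Rightarrow> ratfun" where
    "\<And>J a. J \<subseteq> {1..n} \<Longrightarrow> complete_value (shifted_power_sums n J) a =
      (\<Sum>e\<le>n. coeff (mixed_poly n xvar tvar J) e * g (a - int n + int e))"
proof -
  define s where "s i = power_sum_pleth (i + 1) (Xtq n)" for i
  let ?u = "\<lambda>j. 1 - fps_const (tvar * xvar j) * fps_X" and ?v = "\<lambda>j. 1 - fps_const (xvar j) * fps_X"
  define G where "G = complete_fps s * inverse (\<Prod>j\<in>{1..n}. ?u j)"
  \<comment> \<open>Extension by zero keeps the formula valid for negative indices: with
    \<open>a < 0\<close> and \<open>e \<le> n\<close> every argument of \<open>g\<close> is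
    negative.\<close>
  define g where "g a = (if a < 0 then 0 else fps_nth G (nat a))" for a :: int
  have "complete_value (shifted_power_sums n J) a =
      (\<Sum>e\<le>n. coeff (mixed_poly n xvar tvar J) e * g (a - int n + int e))"
    if J: "J \<subseteq> {1..n}" for J a
  proof (cases "a < 0")
    case True
    then show ?thesis by (simp add: complete_value_def g_def)
  next
    case False
    then obtain b where a: "a = int b" by (metis nonneg_int_cases not_less)
    have fin: "finite J" using J finite_subset by blast
    define p where "p = reflect_poly (mixed_poly n xvar tvar J)"
    have eq: "complete_fps (shifted_power_sums n J) * (\<Prod>j\<in>J. ?u j) = complete_fps s * (\<Prod>j\<in>J. ?v j)"
      using complete_fps_add_letters[OF fin, of s tvar xvar]
      by (simp only: shifted_power_sums_def[abs_def] s_def)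
    have "(\<Prod>j\<in>{1..n}. ?u j) = (\<Prod>j\<in>{1..n} - J. ?u j) * (\<Prod>j\<in>J. ?u j)"
      by (rule prod.subset_diff[OF J]) simp
    then have "G * fps_of_poly p * (\<Prod>j\<in>J. ?u j) =
        complete_fps s * (\<Prod>j\<in>J. ?v j) * (inverse (\<Prod>j\<in>{1..n}. ?u j) * (\<Prod>j\<in>{1..n}. ?u j))"
      by (simp only: G_def p_def fps_of_reflect_mixed_poly mult_ac)
    also have "inverse (\<Prod>j\<in>{1..n}. ?u j) * (\<Prod>j\<in>{1..n}. ?u j) = 1"
      by (rule inverse_mult_eq_1) (simp only: fps_prod_linear_nth_0, simp)
    finally have "complete_fps (shifted_power_sums n J) * (\<Prod>j\<in>J. ?u j) = G * fps_of_poly p * (\<Prod>j\<in>J. ?u j)"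
      using eq by (simp only: mult_1_right)
    moreover have "(\<Prod>j\<in>J. ?u j) \<noteq> 0"
      using fps_prod_linear_nth_0[of "\<lambda>j. tvar * xvar j" J] by (metis fps_zero_nth zero_neq_one)
    ultimately have C: "complete_fps (shifted_power_sums n J) = fps_of_poly p * G"
      by (simp only: mult_cancel_right mult.commute) blast
    have "complete_value (shifted_power_sums n J) a = fps_nth (fps_of_poly p * G) b"
      unfolding C[symmetric] by (simp add: complete_fps_def a)
    also have "\<dots> = (\<Sum>m = 0..b. coeff p m * g (a - int m))"
      unfolding fps_mult_nth by (intro sum.cong) (auto simp: g_def a nat_diff_distrib of_nat_diff)
    also have "\<dots> = (\<Sum>m\<in>{0..b} \<union> {..n}. coeff p m * g (a - int m))"
      by (rule sum.mono_neutral_left) (auto simp: g_def a)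
    also have "\<dots> = (\<Sum>m\<le>n. coeff p m * g (a - int m))"
    proof (rule sum.mono_neutral_right)
      have "coeff p m = 0" if "n < m" for m
        using that by (simp add: p_def coeff_reflect_poly degree_mixed_poly[OF J])
      then show "\<forall>m\<in>({0..b} \<union> {..n}) - {..n}. coeff p m * g (a - int m) = 0" by auto
    qed auto
    \<comment> \<open>The degree is exactly \<open>n\<close>, so reversal exchanges the coefficients
      at \<open>m\<close> and \<open>n - m\<close>.\<close>
    also have "\<dots> = (\<Sum>e\<le>n. coeff (mixed_poly n xvar tvar J) e * g (a - int n + int e))"
      by (rule sum.reindex_bij_witness[where i = "\<lambda>e. n - e" and j = "\<lambda>m. n - m"])
        (auto simp: p_def coeff_reflect_poly degree_mixed_poly[OF J] of_nat_diff algebra_simps)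
    finally show ?thesis .
  qed
  then show thesis by (rule that)
qed

text \<open>Multiplying by the monomial of degree \<open>c\<close> shifts the moments by
  \<open>c\<close>; with \<open>c < n\<close> all indices stay below \<open>2 * n\<close>.\<close>

lemma sum_coeff_monom_mult:
  fixes p :: "'a::comm_ring_1 poly"
  assumes "degree p \<le> n" "c < n"
  shows "(\<Sum>d<2 * n. coeff (monom 1 c * p) d * \<gamma> d) = (\<Sum>e\<le>n. coeff p e * \<gamma> (e + c))"
proof -
  have "(\<Sum>d<2 * n. coeff (monom 1 c * p) d * \<gamma> d) = (\<Sum>d = 0 + c..n + c. coeff (monom 1 c * p) d * \<gamma> d)"
    using assms by (intro sum.mono_neutral_right) (auto simp: coeff_monom_mult coeff_eq_0 not_le)
  also have "\<dots> = (\<Sum>e = 0..n. coeff (monom 1 c * p) (e + c) * \<gamma> (e + c))"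
    by (rule sum.shift_bounds_cl_nat_ivl)
  finally show ?thesis by (simp add: coeff_monom_mult atMost_atLeast0)
qed

theorem theorem2p1:
  fixes n k :: nat and lam :: "nat \<Rightarrow> nat"
  assumes "1 \<le> n" and "1 \<le> k" and "k \<le> n"
    and "antimono_on {1..n} lam"
  shows "macdonald n k (schur_pleth n lam (Xtq n)) =
    (\<Sum>I | I \<subseteq> {1..n} \<and> card I = k. tvar ^ (\<Sum>i\<in>I. n - i) * det (D_mat n lam I))"
proof -
  let ?F = "{I. I \<subseteq> {1..n} \<and> card I = k}"
  obtain g :: "int \<Rightarrow> ratfun" where g: "\<And>J a. J \<subseteq> {1..n} \<Longrightarrow>
      complete_value (shifted_power_sums n J) a =
      (\<Sum>e\<le>n. coeff (mixed_poly n xvar tvar J) e * g (a - int n + int e))"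
    using complete_value_shifted[of n] by blast
  \<comment> \<open>Moments of row \<open>r\<close>, which is 0-based as in \<open>mat\<close>. The
    column index is left out because it enters as the monomial factor of degree
    \<open>c\<close>.\<close>
  define \<gamma> where "\<gamma> r d = g (int (lam (r + 1)) - int r - int n + int d)" for r d :: nat
  define ev where "ev r p = (\<Sum>d<2 * n. coeff p d * \<gamma> r d)" for r p
  have entry: "complete_value (shifted_power_sums n J) (jt_index lam (r + 1) (c + 1)) =
      ev r (monom 1 c * mixed_poly n xvar tvar J)" if "J \<subseteq> {1..n}" "c < n" for J r c
    unfolding ev_def using that
    by (subst sum_coeff_monom_mult) (auto simp: degree_mixed_poly g \<gamma>_def jt_index_def algebra_simps)
  have inj_x: "inj_on xvar A" for A by (simp add: inj_on_def)
  have inj_tx: "inj_on (\<lambda>i. tvar * xvar i) A" for A by (simp add: inj_on_def)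
  have schur: "schur_pleth n lam (Xtq n) = shifted_schur n lam {}"
    by (simp add: schur_pleth_def shifted_schur_def pleth_complete_sym shifted_power_sums_def[abs_def])
  have shifted: "shifted_schur n lam I = det (mat n n (\<lambda>(r, c). ev r (monom 1 c * mixed_poly n xvar tvar I)))"
    if "I \<subseteq> {1..n}" for I
    unfolding shifted_schur_def using that
    by (intro arg_cong[of _ _ det] cong_mat refl, unfold prod.case) (rule entry)
  \<comment> \<open>A column in \<open>I\<close> carries the alphabet \<open>Xtq n + Xt n\<close>,
    which is the full shift \<open>J = {1..n}\<close>; the other columns are unshifted.\<close>
  have D: "D_mat n lam I = mat n n (\<lambda>(r, c).
      ev r (monom 1 c * mixed_poly n xvar tvar (if c + 1 \<in> I then {1..n} else {})))" for I
    unfolding D_mat_def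
  proof (intro cong_mat refl, unfold prod.case)
    fix r c assume "c < n"
    have "(\<lambda>i. power_sum_pleth (i + 1) (if c + 1 \<in> I then Xtq n + Xt n else Xtq n)) =
        shifted_power_sums n (if c + 1 \<in> I then {1..n} else {})"
      by (rule ext) (simp add: shifted_power_sums_def power_sum_pleth_Xtq_add_Xt del: power_Suc)
    then show "pleth (complete_sym (jt_index lam (r + 1) (c + 1))) (if c + 1 \<in> I then Xtq n + Xt n else Xtq n) =
        ev r (monom 1 c * mixed_poly n xvar tvar (if c + 1 \<in> I then {1..n} else {}))"
      unfolding pleth_complete_sym using entry[OF _ \<open>c < n\<close>] by simp
  qed
  have "macdonald n k (schur_pleth n lam (Xtq n)) = tvar ^ (k choose 2) * (\<Sum>I\<in>?F.
      (\<Prod>i\<in>I. \<Prod>j\<in>{1..n} - I. tvar * xvar i - xvar j) / (\<Prod>i\<in>I. \<Prod>j\<in>{1..n} - I. xvar i - xvar j) *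
      det (mat n n (\<lambda>(r, c). ev r (monom 1 c * mixed_poly n xvar tvar I))))"
    unfolding macdonald_def resultant_image[OF inj_x inj_x] resultant_image[OF inj_tx inj_x] schur
  proof (intro arg_cong2[of _ _ _ _ "(*)"] sum.cong refl)
    fix I assume I: "I \<in> ?F"
    then have "finite I" using finite_subset by blast
    then have "fold Theta (sorted_list_of_set I) (shifted_schur n lam {}) = shifted_schur n lam I"
      using I fold_Theta_shifted_schur[of "sorted_list_of_set I" n "{}" lam] by simp
    then show "fold Theta (sorted_list_of_set I) (shifted_schur n lam {}) =
        det (mat n n (\<lambda>(r, c). ev r (monom 1 c * mixed_poly n xvar tvar I)))"
      using I shifted by simp
  qed
  also have "\<dots> = (\<Sum>I\<in>?F. tvar ^ (\<Sum>i\<in>I. n - i) * det (mat n n (\<lambda>(r, c).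
      ev r (monom 1 c * mixed_poly n xvar tvar (if c + 1 \<in> I then {1..n} else {})))))"
    unfolding ev_def
    by (rule det_moment_identity) (auto simp: inj_on_def rvar_mult_neq_rvar)
  finally show ?thesis unfolding D .
qed

end
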